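(* Let $N\ge2$ and let $q\in\mathbb{C}$, $q\neq0$, not be a root of unity. Let $v_m$ $(1\le m\le N-1)$ and $a_{mn}$ $(1\le n\le m\le N-1)$ be formal non-commuting variables, and let $T^+$, $U^+$ be the matrices formed from them as in the context. The product $Z=T^+U^+$ is a $GL_q(N)$ matrix if and only if the following $q$-commutation relations hold: - $a_{mn}v_m=q^2v_ma_{mn}$ for all $n$; - $a_{mn}a_{mn'}=q^2a_{mn'}a_{mn}$ for $n>n'$; - $a_{mn}a_{m-1,n'}=q^2a_{m-1,n'}a_{mn}$ for $n\le n'$; - all other pairs of variables commute. Furthermore, in this case the cluster variables $x_{i,i+j}$ of $Z=T^+U^+$ $(i,j\ge1,\ i+j\le N)$ can be written as $$x_{i,i+j}=\left(\prod_{m=1}^{i}\prod_{n=1}^{j}a_{m+n-1,n}\right)\prod_{k=1}^{i-1}v_k=(a_{11}a_{22}\cdots a_{jj})(a_{21}a_{32}\cdots a_{j+1,j})\cdots(a_{i,1}\cdots a_{i+j-1,j})(v_1v_2\cdots v_{i-1}),$$ in this particular order. Finally, for every $GL_q(N)$ matrix, the cluster variables $x_{i,i+j}$, $x_{k,k+l}$ ($i,j,k,l\ge1$, $i+j\le N$, $k+l\le N$) satisfy $$x_{i,i+j}\,x_{k,k+l}=q^{2P(i,j;k,l)}\,x_{k,k+l}\,x_{i,i+j},$$ where for $j\le l$ $$P(i,j;k,l)=\#\{(m,n): l+2\le m+n\le k+l+1,\ 1\le m\le i,\ 1\le n\le j\}-\#\{(m,n): 1\le m+n\le i,\ 1\le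 m\le k,\ 1\le n\le l\},$$ and $P(k,l;i,j)=-P(i,j;k,l)$.
   Context: **$GL_q(N)$ matrix.** An $N\times N$ matrix $Z=(z_{ij})$ with entries in an associative algebra is a $GL_q(N)$ matrix if for all $i<i'$, $j<j'$ the entries $\alpha=z_{ij},\ \beta=z_{ij'},\ \gamma=z_{i'j},\ \delta=z_{i'j'}$ satisfy $\alpha\beta=\beta\alpha$, $\gamma\delta=\delta\gamma$, $\alpha\gamma=q^2\gamma\alpha$, $\beta\delta=q^2\delta\beta$, $\beta\gamma=q^2\gamma\beta$, $\alpha\delta-\beta\gamma=\delta\alpha-\gamma\beta$. **The matrices.** With matrix units $E_{i,j}$ and identity $I$: $T^+=\mathrm{diag}(1,v_1,v_2,\dots,v_{N-1})$ and $U^+=A_1A_2\cdots A_{N-1}$, where $A_s=I+\sum_{m=s}^{N-1}a_{m,s}E_{m,m+1}$. The variables $v_m,a_{mn}$ are formal variables whose inverses may be formed (i.e. they are invertible in the algebra considered). **Cluster variables.** The quantum determinant of a $k\times k$ matrix $(w_{ij})$ is $\sum_{\sigma\in S_k}(-1)^\sigma w_{1,\sigma(1)}\cdots w_{k,\sigma(k)}$. For $1\le i<j\le N$, $x_{ij}$ is the quantum determinant of the $i\times i$ initial minor with lower right corner at $(i,j)$, i.e. rows $1,\dots,i$ and columns $j-i+1,\dots,j$, of the matrix $Z$ under consideration. *)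

theory Defs
  imports Complex_Main "HOL-Combinatorics.Permutations" "Jordan_Normal_Form.Matrix"
begin

locale complex_algebra = vector_space scale
  for scale :: "complex \<Rightarrow> 'a::ring_1 \<Rightarrow> 'a" +
  assumes scale_mult_left: "scale c x * y = scale c (x * y)"
    and scale_mult_right: "x * scale c y = scale c (x * y)"

definition invertible_elem :: "'a::ring_1 \<Rightarrow> bool" where
  "invertible_elem x \<longleftrightarrow> (\<exists>y. x * y = 1 \<and> y * x = 1)"

text \<open>Matrices have zero-based indices: the entry \<open>z\<^sub>i\<^sub>j\<close> of the mathematical text is
  \<open>Z $$ (i - 1, j - 1)\<close>. The indices of the variables \<open>v\<^sub>m\<close>, \<open>a\<^sub>m\<^sub>n\<close> and of the cluster
  variables \<open>x\<^sub>i\<^sub>j\<close> keep their original, one-based meaning.\<close>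

definition GLq_mat :: "(complex \<Rightarrow> 'a \<Rightarrow> 'a) \<Rightarrow> complex \<Rightarrow> nat \<Rightarrow> 'a::ring_1 mat \<Rightarrow> bool" where
  "GLq_mat scale q N Z \<longleftrightarrow> Z \<in> carrier_mat N N \<and>
     (\<forall>i i' j j'. i < i' \<and> i' < N \<and> j < j' \<and> j' < N \<longrightarrow>
       (let \<alpha> = Z $$ (i, j); \<beta> = Z $$ (i, j'); \<gamma> = Z $$ (i', j); \<delta> = Z $$ (i', j')
        in \<alpha> * \<beta> = \<beta> * \<alpha> \<and>
           \<gamma> * \<delta> = \<delta> * \<gamma> \<and>
           \<alpha> * \<gamma> = scale (q\<^sup>2) (\<gamma> * \<alpha>) \<and>
           \<beta> * \<delta> = scale (q\<^sup>2) (\<delta> * \<beta>) \<and>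
           \<beta> * \<gamma> = scale (q\<^sup>2) (\<gamma> * \<beta>) \<and>
           \<alpha> * \<delta> - \<beta> * \<gamma> = \<delta> * \<alpha> - \<gamma> * \<beta>))"

definition T_plus :: "nat \<Rightarrow> (nat \<Rightarrow> 'a::ring_1) \<Rightarrow> 'a mat" where
  "T_plus N v = mat_diag N (\<lambda>i. if i = 0 then 1 else v i)"

text \<open>With zero-based indices the matrix unit \<open>E\<^sub>m\<^sub>,\<^sub>m\<^sub>+\<^sub>1\<close> sits in row \<open>m - 1\<close> and
  column \<open>m\<close>, so below \<open>j = m\<close>.\<close>

definition A_mat :: "nat \<Rightarrow> (nat \<Rightarrow> nat \<Rightarrow> 'a::ring_1) \<Rightarrow> nat \<Rightarrow> 'a mat" where
  "A_mat N a s = 1\<^sub>m N + mat N N (\<lambda>(i, j). if j = i + 1 \<and> s \<le> j then a j s else 0)"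

definition U_plus :: "nat \<Rightarrow> (nat \<Rightarrow> nat \<Rightarrow> 'a::ring_1) \<Rightarrow> 'a mat" where
  "U_plus N a = foldr (*) (map (A_mat N a) [1..<N]) (1\<^sub>m N)"

definition qdet :: "'a::ring_1 mat \<Rightarrow> 'a" where
  "qdet W = (\<Sum>p | p permutes {0..<dim_row W}.
     of_int (sign p) * (\<Prod>r\<leftarrow>[0..<dim_row W]. W $$ (r, p r)))"

definition cluster_var :: "'a::ring_1 mat \<Rightarrow> nat \<Rightarrow> nat \<Rightarrow> 'a" where
  "cluster_var Z i j = qdet (mat i i (\<lambda>(r, c). Z $$ (r, j - i + c)))"

datatype var = V nat | A nat nat

definition vars :: "nat \<Rightarrow> var set" where
  "vars N = {V m |m. 1 \<le> m \<and> m \<le> N - 1} \<union> {A m n |m n. 1 \<le> n \<and> n \<le> m \<and> m \<le> N - 1}"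

primrec var_val :: "(nat \<Rightarrow> 'a) \<Rightarrow> (nat \<Rightarrow> nat \<Rightarrow> 'a) \<Rightarrow> var \<Rightarrow> 'a" where
  "var_val v a (V m) = v m"
| "var_val v a (A m n) = a m n"

text \<open>The ordered pairs \<open>(x, y)\<close> of variables for which \<open>x y = q\<^sup>2 y x\<close> is required.\<close>

fun q_pair :: "var \<Rightarrow> var \<Rightarrow> bool" where
  "q_pair (A m n) (V m') \<longleftrightarrow> m' = m"
| "q_pair (A m n) (A m' n') \<longleftrightarrow> (m' = m \<and> n > n') \<or> (m = m' + 1 \<and> n \<le> n')"
| "q_pair (V m) y \<longleftrightarrow> False"

definition q_relations ::
  "(complex \<Rightarrow> 'a \<Rightarrow> 'a) \<Rightarrow> complex \<Rightarrow> nat \<Rightarrow> (nat \<Rightarrow> 'a::ring_1) \<Rightarrow> (nat \<Rightarrow> nat \<Rightarrow> 'a) \<Rightarrow> bool" where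
  "q_relations scale q N v a \<longleftrightarrow>
     (\<forall>x\<in>vars N. \<forall>y\<in>vars N.
        (q_pair x y \<longrightarrow>
           var_val v a x * var_val v a y = scale (q\<^sup>2) (var_val v a y * var_val v a x)) \<and>
        (\<not> q_pair x y \<and> \<not> q_pair y x \<longrightarrow>
           var_val v a x * var_val v a y = var_val v a y * var_val v a x))"

definition P_count :: "nat \<Rightarrow> nat \<Rightarrow> nat \<Rightarrow> nat \<Rightarrow> int" where
  "P_count i j k l =
     int (card {(m, n). l + 2 \<le> m + n \<and> m + n \<le> k + l + 1 \<and> 1 \<le> m \<and> m \<le> i \<and> 1 \<le> n \<and> n \<le> j})
   - int (card {(m, n). 1 \<le> m + n \<and> m + n \<le> i \<and> 1 \<le> m \<and> m \<le> k \<and> 1 \<le> n \<and> n \<le> l})"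

text \<open>For \<open>j = l\<close> the counting formula applies to both \<open>P(i,j;k,l)\<close> and \<open>P(k,l;i,j)\<close>, so there
  antisymmetry is a property of the formula rather than part of the definition.\<close>

definition P_exp :: "nat \<Rightarrow> nat \<Rightarrow> nat \<Rightarrow> nat \<Rightarrow> int" where
  "P_exp i j k l = (if j \<le> l then P_count i j k l else - P_count k l i j)"

end

theory Submission
  imports Defs "Jordan_Normal_Form.Determinant"
begin

text \<open>
  Put \<open>p = q\<^sup>2\<close>. A finite matrix is extended by zeros to all indices, which preserves the
  relations of a \<open>GL\<^sub>q\<close> matrix, so that no index bounds are needed.

  \<^bold>\<open>Commutation of cluster variables.\<close> The relations say two things. The row forms
  \<open>\<omega>\<^sub>r = \<Sum>\<^sub>c z\<^sub>r\<^sub>c e\<^sub>c\<close> with coefficients in the ordinary exterior algebra on the columns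
  anticommute and square to zero; the column forms \<open>\<eta>\<^sub>b = \<Sum>\<^sub>s z\<^sub>s\<^sub>b f\<^sub>s\<close>, where now
  \<open>f\<^sub>t f\<^sub>s = - p f\<^sub>s f\<^sub>t\<close> for \<open>s < t\<close>, satisfy \<open>\<eta>\<^sub>b \<eta>\<^sub>a = - p \<eta>\<^sub>a \<eta>\<^sub>b\<close> for \<open>a < b\<close> and square to
  zero. The quantum minors are the coefficients of products of either kind. They therefore have a
  Laplace expansion along any row, with row entries on the left, and along any column, with column
  entries on the right. Let \<open>D\<close> be the minor of rows \<open>0, \<dots>, i - 1\<close> and an interval \<open>J\<close> of \<open>i\<close>
  columns, and \<open>D\<^sub>s\<^sub>c\<close> the minor without row \<open>s\<close> and column \<open>c\<close>. Evaluating a signed double sum of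
  \<open>z\<^sub>r\<^sub>c D\<^sub>s\<^sub>c z\<^sub>s\<^sub>b\<close> over \<open>s\<close> and \<open>c\<close> by row expansions gives a multiple of \<open>D z\<^sub>r\<^sub>b\<close>, by column
  expansions a multiple of \<open>z\<^sub>r\<^sub>b D\<close>, for every column \<open>b\<close>, inside \<open>J\<close> or not. So \<open>D\<close> commutes up
  to a power of \<open>p\<close> with all entries of its rows (\<open>minor_commute_entry\<close>), and hence with every
  other minor of this kind that is not larger than itself (\<open>minor_commute_minor\<close>). The lemma
  \<open>P_exp_eq_sum\<close> identifies the exponent with the difference of two lattice point counts.

  \<^bold>\<open>The equivalence.\<close> The product \<open>T\<^sup>+ U\<^sup>+\<close> arises from the diagonal matrix \<open>T\<^sup>+\<close> by elementary
  column operations: each adds to one column its left neighbour times one variable \<open>b = a\<^sub>m\<^sub>n\<close>. If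
  \<open>b\<close> commutes with all columns but the changed one, and commutes with that one up to the factor
  \<open>p\<close>, then the relations hold before the operation if and only if they hold after it
  (\<open>qmat_add_col_iff\<close>). Apart from the commutation of the \<open>v\<^sub>m\<close>, the q-commutation relations express
  exactly that every \<open>a\<^sub>m\<^sub>n\<close> behaves like this at the moment when it is used. They also follow from the
  \<open>GL\<^sub>q\<close> relations: the topmost nonzero entry of a column after the operation is \<open>u b\<close> with an
  invertible entry \<open>u\<close> to its left, so that \<open>b\<close> is a quotient of two entries of the resulting
  matrix, and its commutation with all entries can be computed (\<open>split_off_col\<close>). Undoing the
  operations one at a time recovers all relations (\<open>qmat_imp_torus_relations\<close>).

  \<^bold>\<open>The monomials.\<close> Once the columns \<open>j, \<dots>, j + i - 1\<close> have received the variables \<open>a\<^sub>m\<^sub>n\<close> with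
  \<open>n \<le> j\<close>, the submatrix in the first \<open>i\<close> rows is triangular and its minor is the product of its
  diagonal. All later operations that touch these columns add a column that belongs to the minor
  itself, and do not change it.
\<close>

section \<open>Alternating sums over pairs\<close>

text \<open>Squares and (twisted) anticommutators of row and column forms vanish by this cancellation in
  pairs.\<close>
lemma sum_distinct_pairs_0:
  fixes f :: "nat \<Rightarrow> nat \<Rightarrow> 'b::ab_group_add"
  assumes "finite S" "\<And>a b. a \<in> S \<Longrightarrow> b \<in> S \<Longrightarrow> a < b \<Longrightarrow> f a b + f b a = 0"
  shows "(\<Sum>a\<in>S. \<Sum>b\<in>S - {a}. f a b) = 0"
  using assms
proof (induction S rule: finite_linorder_max_induct)
  case empty
  then show ?case by simp
next
  case (insert x S)
  have x: "x \<notin> S" using insert.hyps by auto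
  have "(\<Sum>b\<in>insert x S - {a}. f a b) = f a x + (\<Sum>b\<in>S - {a}. f a b)" if "a \<in> S" for a
  proof -
    have "insert x S - {a} = insert x (S - {a})" using that x by auto
    then show ?thesis using x insert.hyps by simp
  qed
  moreover have "insert x S - {x} = S" using x by auto
  ultimately have "(\<Sum>a\<in>insert x S. \<Sum>b\<in>insert x S - {a}. f a b)
      = (\<Sum>b\<in>S. f x b) + (\<Sum>a\<in>S. f a x + (\<Sum>b\<in>S - {a}. f a b))"
    using x insert.hyps by simp
  also have "\<dots> = (\<Sum>a\<in>S. f a x + f x a) + (\<Sum>a\<in>S. \<Sum>b\<in>S - {a}. f a b)"
    by (simp add: sum.distrib algebra_simps)
  also have "(\<Sum>a\<in>S. f a x + f x a) = 0"
    using insert.hyps insert.prems by (intro sum.neutral) auto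
  also have "(\<Sum>a\<in>S. \<Sum>b\<in>S - {a}. f a b) = 0"
    using insert by simp
  finally show ?case by simp
qed

text \<open>The exponents of the signs and powers of \<open>p\<close> in Laplace expansions.\<close>
definition n_below :: "nat set \<Rightarrow> nat \<Rightarrow> nat" where
  "n_below S c = card {d \<in> S. d < c}"

definition n_above :: "nat set \<Rightarrow> nat \<Rightarrow> nat" where
  "n_above S c = card {d \<in> S. c < d}"

lemma n_below_remove:
  "finite S \<Longrightarrow> a \<in> S \<Longrightarrow> a < b \<Longrightarrow> n_below S b = Suc (n_below (S - {a}) b)"
  "b \<le> a \<Longrightarrow> n_below (S - {a}) b = n_below S b"
proof -
  assume *: "finite S" "a \<in> S" "a < b"
  have "{d \<in> S. d < b} = insert a {d \<in> S - {a}. d < b}" using * by auto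
  then show "n_below S b = Suc (n_below (S - {a}) b)"
    using * by (simp add: n_below_def)
next
  assume "b \<le> a"
  then have "{d \<in> S - {a}. d < b} = {d \<in> S. d < b}" by auto
  then show "n_below (S - {a}) b = n_below S b" by (simp add: n_below_def)
qed

lemma n_above_remove:
  "finite S \<Longrightarrow> a \<in> S \<Longrightarrow> b < a \<Longrightarrow> n_above S b = Suc (n_above (S - {a}) b)"
  "a \<le> b \<Longrightarrow> n_above (S - {a}) b = n_above S b"
proof -
  assume *: "finite S" "a \<in> S" "b < a"
  have "{d \<in> S. b < d} = insert a {d \<in> S - {a}. b < d}" using * by auto
  then show "n_above S b = Suc (n_above (S - {a}) b)"
    using * by (simp add: n_above_def)
next
  assume "a \<le> b"
  then have "{d \<in> S - {a}. b < d} = {d \<in> S. b < d}" by auto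
  then show "n_above (S - {a}) b = n_above S b" by (simp add: n_above_def)
qed

lemma n_below_insert:
  "finite S \<Longrightarrow> a \<notin> S \<Longrightarrow> a < b \<Longrightarrow> n_below (insert a S) b = Suc (n_below S b)"
  "b \<le> a \<Longrightarrow> n_below (insert a S) b = n_below S b"
  using n_below_remove(1)[of "insert a S" a b] n_below_remove(2)[of b a "insert a S"]
    n_below_remove(2)[of b a S]
  by auto

lemma n_above_insert:
  "finite S \<Longrightarrow> a \<notin> S \<Longrightarrow> b < a \<Longrightarrow> n_above (insert a S) b = Suc (n_above S b)"
  "a \<le> b \<Longrightarrow> n_above (insert a S) b = n_above S b"
  using n_above_remove(1)[of "insert a S" a b] n_above_remove(2)[of a b "insert a S"]
    n_above_remove(2)[of a b S]
  by auto

lemma n_below_all: "(\<And>d. d \<in> S \<Longrightarrow> d < c) \<Longrightarrow> n_below S c = card S"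
  unfolding n_below_def by (rule arg_cong[where f=card]) auto

lemma n_below_none: "(\<And>d. d \<in> S \<Longrightarrow> c \<le> d) \<Longrightarrow> n_below S c = 0"
  unfolding n_below_def by (force simp: card_eq_0_iff)

lemma n_above_all: "(\<And>d. d \<in> S \<Longrightarrow> c < d) \<Longrightarrow> n_above S c = card S"
  unfolding n_above_def by (rule arg_cong[where f=card]) auto

lemma n_above_none: "(\<And>d. d \<in> S \<Longrightarrow> d \<le> c) \<Longrightarrow> n_above S c = 0"
  unfolding n_above_def by (force simp: card_eq_0_iff)

section \<open>Row and column operators\<close>
context complex_algebra
begin

lemmas scale_algebra =
  scale_mult_left scale_mult_right

lemma scale_cancel: "c \<noteq> 0 \<Longrightarrow> scale c x = scale c y \<longleftrightarrow> x = y"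
  by simp

text \<open>The relations of a \<open>GL\<^sub>q\<close> matrix with \<open>p = q\<^sup>2\<close>, for an array that is indexed by all natural
  numbers. An \<open>N \<times> N\<close> matrix extended by zeros qualifies, because every relation that involves an
  index outside the matrix reads \<open>0 = 0\<close>.\<close>
definition qmat :: "complex \<Rightarrow> (nat \<Rightarrow> nat \<Rightarrow> 'a) \<Rightarrow> bool" where
  "qmat p Z \<longleftrightarrow>
     (\<forall>r a b. Z r a * Z r b = Z r b * Z r a) \<and>
     (\<forall>r s a. r < s \<longrightarrow> Z r a * Z s a = scale p (Z s a * Z r a)) \<and>
     (\<forall>r s a b. r < s \<longrightarrow> a < b \<longrightarrow>
        Z r b * Z s a = scale p (Z s a * Z r b) \<and>
        Z r a * Z s b - Z r b * Z s a = Z s b * Z r a - Z s a * Z r b)"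

lemma qmatD:
  assumes "qmat p Z"
  shows qmat_row: "Z r a * Z r b = Z r b * Z r a"
    and qmat_col: "r < s \<Longrightarrow> Z r a * Z s a = scale p (Z s a * Z r a)"
    and qmat_anti: "r < s \<Longrightarrow> a < b \<Longrightarrow> Z r b * Z s a = scale p (Z s a * Z r b)"
    and qmat_det: "r < s \<Longrightarrow> a < b \<Longrightarrow>
      Z r a * Z s b - Z r b * Z s a = Z s b * Z r a - Z s a * Z r b"
  using assms unfolding qmat_def by blast+

text \<open>A function \<open>\<Psi>\<close> on finite sets of columns stands for the element \<open>\<Sum>\<^sub>J \<Psi>(J) e\<^sub>J\<close> of the exterior
  algebra on the columns. Then \<open>row_op Z r\<close> is multiplication by the row form \<open>\<omega>\<^sub>r\<close> from the left.
  Dually, \<open>col_op p Z b\<close> is multiplication by the column form \<open>\<eta>\<^sub>b\<close> from the right, on elements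
  \<open>\<Sum>\<^sub>I \<Psi>(I) f\<^sub>I\<close> of the algebra with \<open>f\<^sub>t f\<^sub>s = - p f\<^sub>s f\<^sub>t\<close> for \<open>s < t\<close>.\<close>
definition row_op :: "(nat \<Rightarrow> nat \<Rightarrow> 'a) \<Rightarrow> nat \<Rightarrow> (nat set \<Rightarrow> 'a) \<Rightarrow> nat set \<Rightarrow> 'a" where
  "row_op Z r \<Psi> J = (\<Sum>c\<in>J. scale ((-1) ^ n_below J c) (Z r c * \<Psi> (J - {c})))"

definition col_op :: "complex \<Rightarrow> (nat \<Rightarrow> nat \<Rightarrow> 'a) \<Rightarrow> nat \<Rightarrow> (nat set \<Rightarrow> 'a) \<Rightarrow> nat set \<Rightarrow> 'a" where
  "col_op p Z b \<Psi> I = (\<Sum>s\<in>I. scale ((-p) ^ n_above I s) (\<Psi> (I - {s}) * Z s b))"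

text \<open>The coefficient of \<open>e\<^sub>J\<close> in the product of the row forms \<open>\<omega>\<^sub>r\<close>, \<open>r \<in> I\<close>, in increasing order;
  it vanishes unless \<open>I\<close> and \<open>J\<close> have the same size. For initial rows and an interval of columns it
  is a cluster variable.\<close>
definition minor :: "(nat \<Rightarrow> nat \<Rightarrow> 'a) \<Rightarrow> nat set \<Rightarrow> nat set \<Rightarrow> 'a" where
  "minor Z I = foldr (row_op Z) (sorted_list_of_set I) (\<lambda>J. if J = {} then 1 else 0)"

lemma minor_empty: "minor Z {} J = (if J = {} then 1 else 0)"
  by (simp add: minor_def)

lemma minor_insert_min:
  assumes "finite I" "\<And>t. t \<in> I \<Longrightarrow> r < t"
  shows "minor Z (insert r I) = row_op Z r (minor Z I)"
proof -
  have "r \<notin> I" using assms(2) by auto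
  moreover have "insort r (sorted_list_of_set I) = r # sorted_list_of_set I"
    using assms by (intro insort_is_Cons) (auto intro: less_imp_le)
  ultimately have "sorted_list_of_set (insert r I) = r # sorted_list_of_set I"
    using assms(1) by (simp add: sorted_list_of_set_insert)
  then show ?thesis by (simp add: minor_def fun_eq_iff)
qed

lemma row_op_cong: "(\<And>c. c \<in> J \<Longrightarrow> \<Psi> (J - {c}) = \<Phi> (J - {c})) \<Longrightarrow> row_op Z r \<Psi> J = row_op Z r \<Phi> J"
  unfolding row_op_def by (intro sum.cong) auto

lemma row_op_scale: "row_op Z r (\<lambda>J. scale k (\<Psi> J)) J = scale k (row_op Z r \<Psi> J)"
  unfolding row_op_def scale_sum_right
  by (intro sum.cong) (auto simp: scale_algebra mult.commute)

lemma row_op_0: "row_op Z r (\<lambda>J. 0) J = 0"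
  unfolding row_op_def by simp

lemma col_op_cong: "(\<And>s. s \<in> I \<Longrightarrow> \<Psi> (I - {s}) = \<Phi> (I - {s})) \<Longrightarrow> col_op p Z b \<Psi> I = col_op p Z b \<Phi> I"
  unfolding col_op_def by (intro sum.cong) auto

lemma col_op_scale: "col_op p Z b (\<lambda>J. scale k (\<Psi> J)) I = scale k (col_op p Z b \<Psi> I)"
  unfolding col_op_def scale_sum_right
  by (intro sum.cong) (auto simp: scale_algebra mult.commute)

lemma col_op_0: "col_op p Z b (\<lambda>J. 0) I = 0"
  unfolding col_op_def by simp

lemma row_op_row_op:
  "row_op Z r (row_op Z s \<Psi>) J = (\<Sum>a\<in>J. \<Sum>b\<in>J - {a}.
     scale ((-1) ^ (n_below J a + n_below (J - {a}) b)) (Z r a * Z s b * \<Psi> (J - {a} - {b})))"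
  unfolding row_op_def
  by (simp add: sum_distrib_left scale_sum_right scale_algebra power_add mult.assoc)

lemma col_op_col_op:
  "col_op p Z a (col_op p Z b \<Psi>) I = (\<Sum>s\<in>I. \<Sum>t\<in>I - {s}.
     scale ((-p) ^ (n_above I s + n_above (I - {s}) t)) (\<Psi> (I - {s} - {t}) * (Z t b * Z s a)))"
  unfolding col_op_def
  by (simp add: sum_distrib_right scale_sum_right scale_algebra power_add mult.assoc)

text \<open>Entries of one row commute, hence \<open>\<omega>\<^sub>r \<omega>\<^sub>r = 0\<close>.\<close>
lemma row_op_same:
  assumes "qmat p Z" "finite J"
  shows "row_op Z r (row_op Z r \<Psi>) J = 0"
  unfolding row_op_row_op
proof (rule sum_distinct_pairs_0[OF assms(2)])
  fix a b assume ab: "a \<in> J" "b \<in> J" "a < b"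
  have "J - {b} - {a} = J - {a} - {b}" by auto
  then show "scale ((-1) ^ (n_below J a + n_below (J - {a}) b)) (Z r a * Z r b * \<Psi> (J - {a} - {b})) +
      scale ((-1) ^ (n_below J b + n_below (J - {b}) a)) (Z r b * Z r a * \<Psi> (J - {b} - {a})) = 0"
    using ab assms(2) qmat_row[OF assms(1), of r a b]
    by (simp add: n_below_remove(1)[of J a b] n_below_remove(2)[of a b J] power_add)
qed

text \<open>The relation \<open>\<alpha>\<delta> - \<beta>\<gamma> = \<delta>\<alpha> - \<gamma>\<beta>\<close> is exactly the anticommutation of two row forms.\<close>
lemma row_op_anticommute:
  assumes "qmat p Z" "finite J" "r < s"
  shows "row_op Z s (row_op Z r \<Psi>) J = - row_op Z r (row_op Z s \<Psi>) J"
proof -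
  have "row_op Z r (row_op Z s \<Psi>) J + row_op Z s (row_op Z r \<Psi>) J = 0"
    unfolding row_op_row_op sum.distrib[symmetric]
  proof (rule sum_distinct_pairs_0[OF assms(2)])
    fix a b assume ab: "a \<in> J" "b \<in> J" "a < b"
    let ?x = "\<Psi> (J - {a} - {b})"
    have eq: "J - {b} - {a} = J - {a} - {b}" by auto
    have "(Z r a * Z s b - Z r b * Z s a - (Z s b * Z r a - Z s a * Z r b)) * ?x = 0"
      using qmat_det[OF assms(1,3) ab(3)] by simp
    then have "Z r a * Z s b * ?x + Z s a * Z r b * ?x - Z r b * Z s a * ?x - Z s b * Z r a * ?x = 0"
      by (simp add: algebra_simps)
    from arg_cong[OF this, of "scale ((-1) ^ (n_below J a + n_below (J - {a}) b))"]
    show "scale ((-1) ^ (n_below J a + n_below (J - {a}) b)) (Z r a * Z s b * \<Psi> (J - {a} - {b})) +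
      scale ((-1) ^ (n_below J a + n_below (J - {a}) b)) (Z s a * Z r b * \<Psi> (J - {a} - {b})) +
      (scale ((-1) ^ (n_below J b + n_below (J - {b}) a)) (Z r b * Z s a * \<Psi> (J - {b} - {a})) +
      scale ((-1) ^ (n_below J b + n_below (J - {b}) a)) (Z s b * Z r a * \<Psi> (J - {b} - {a}))) = 0"
      using ab assms(2) unfolding eq
      by (simp add: n_below_remove(1)[of J a b] n_below_remove(2)[of a b J] power_add
          scale_algebra algebra_simps)
  qed
  then show ?thesis by (metis add_eq_0_iff)
qed

text \<open>The relation \<open>\<alpha>\<gamma> = p \<gamma>\<alpha>\<close> compensates the factor \<open>- p\<close> from exchanging two rows.\<close>
lemma col_op_same:
  assumes "qmat p Z" "finite I"
  shows "col_op p Z a (col_op p Z a \<Psi>) I = 0"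
  unfolding col_op_col_op
proof (rule sum_distinct_pairs_0[OF assms(2)])
  fix s t assume st: "s \<in> I" "t \<in> I" "s < t"
  have "I - {t} - {s} = I - {s} - {t}" by auto
  then show "scale ((-p) ^ (n_above I s + n_above (I - {s}) t)) (\<Psi> (I - {s} - {t}) * (Z t a * Z s a)) +
      scale ((-p) ^ (n_above I t + n_above (I - {t}) s)) (\<Psi> (I - {t} - {s}) * (Z s a * Z t a)) = 0"
    using st assms(2) qmat_col[OF assms(1) st(3), of a]
    by (simp add: n_above_remove(1)[of I t s] n_above_remove(2)[of s t I] power_add scale_algebra
       mult.commute mult.left_commute)
qed

text \<open>Here \<open>\<beta>\<gamma> = p \<gamma>\<beta>\<close>, together with \<open>\<alpha>\<delta> - \<beta>\<gamma> = \<delta>\<alpha> - \<gamma>\<beta>\<close>, turns \<open>\<alpha>\<delta> - p \<gamma>\<beta>\<close> and \<open>\<beta>\<gamma> - p \<delta>\<alpha>\<close>, the two possible coefficients of a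
  pair of rows, into \<open>\<alpha>\<delta> - \<beta>\<gamma>\<close> and its multiple by \<open>- p\<close>.\<close>
lemma col_op_anticommute:
  assumes "qmat p Z" "finite I" "a < b"
  shows "col_op p Z a (col_op p Z b \<Psi>) I = scale (-p) (col_op p Z b (col_op p Z a \<Psi>) I)"
proof -
  have "col_op p Z a (col_op p Z b \<Psi>) I + scale p (col_op p Z b (col_op p Z a \<Psi>) I) = 0"
    unfolding col_op_col_op scale_sum_right sum.distrib[symmetric]
  proof (rule sum_distinct_pairs_0[OF assms(2)])
    fix s t assume st: "s \<in> I" "t \<in> I" "s < t"
    let ?x = "\<Psi> (I - {s} - {t})"
    have eq: "I - {t} - {s} = I - {s} - {t}" by auto
    have 1: "Z s b * Z t a = scale p (Z t a * Z s b)"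
      by (rule qmat_anti[OF assms(1) st(3) assms(3)])
    have "?x * scale p (Z s a * Z t b - Z s b * Z t a - (Z t b * Z s a - Z t a * Z s b)) = 0"
      using qmat_det[OF assms(1) st(3) assms(3)] by simp
    then have "scale p (?x * (Z s a * Z t b)) - scale (p*p) (?x * (Z t a * Z s b))
        - scale p (?x * (Z t b * Z s a)) + ?x * (Z s b * Z t a) = 0"
      by (simp add: scale_algebra algebra_simps 1)
    from arg_cong[OF this, of "scale ((-p) ^ (n_above I t + n_above (I - {t}) s))"]
    show "scale ((-p) ^ (n_above I s + n_above (I - {s}) t)) (\<Psi> (I - {s} - {t}) * (Z t b * Z s a)) +
      scale p (scale ((-p) ^ (n_above I s + n_above (I - {s}) t)) (\<Psi> (I - {s} - {t}) * (Z t a * Z s b))) +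
      (scale ((-p) ^ (n_above I t + n_above (I - {t}) s)) (\<Psi> (I - {t} - {s}) * (Z s b * Z t a)) +
      scale p (scale ((-p) ^ (n_above I t + n_above (I - {t}) s)) (\<Psi> (I - {t} - {s}) * (Z s a * Z t b)))) = 0"
      using st assms(2) unfolding eq
      by (simp add: n_above_remove(1)[of I t s] n_above_remove(2)[of s t I] power_add
          scale_algebra algebra_simps)
  qed
  then show ?thesis by (simp add: eq_neg_iff_add_eq_0)
qed

end

section \<open>Minors\<close>

context complex_algebra
begin

lemma minor_card_neq:
  assumes "finite I" "finite J" "card I \<noteq> card J"
  shows "minor Z I J = 0"
  using assms
proof (induction I arbitrary: J rule: finite_linorder_min_induct)
  case empty
  then show ?case by (auto simp: minor_empty)
next
  case (insert r I)
  have r: "r \<notin> I" using insert.hyps by auto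
  have "minor Z I (J - {c}) = 0" if "c \<in> J" for c
  proof (rule insert.IH)
    show "card I \<noteq> card (J - {c})"
      using card.remove[OF insert.prems(1) that] insert.prems(2) insert.hyps(1) r by auto
  qed (use insert.prems in auto)
  then show ?case
    using insert.hyps by (simp add: minor_insert_min row_op_def)
qed

text \<open>Commutation factors of product form are what makes this work: every term of a minor uses each of
  its rows and columns once, so all terms have the same factor.\<close>
lemma commute_minor:
  assumes "finite I" "finite J"
    and "\<And>r c. r \<in> I \<Longrightarrow> c \<in> J \<Longrightarrow> x * Z r c = scale (f r * g c) (Z r c * x)"
  shows "x * minor Z I J = scale (prod f I * prod g J) (minor Z I J * x)"
  using assms
proof (induction I arbitrary: J rule: finite_linorder_min_induct)
  case empty
  then show ?case by (simp add: minor_empty)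
next
  case (insert r I)
  have r: "r \<notin> I" using insert.hyps by auto
  have "x * (Z r c * minor Z I (J - {c})) =
      scale (prod f (insert r I) * prod g J) (Z r c * minor Z I (J - {c}) * x)" if c: "c \<in> J" for c
  proof -
    have IH: "x * minor Z I (J - {c}) = scale (prod f I * prod g (J - {c})) (minor Z I (J - {c}) * x)"
      using insert.prems by (intro insert.IH) auto
    have "x * (Z r c * minor Z I (J - {c})) = scale (f r * g c) (Z r c * (x * minor Z I (J - {c})))"
      using insert.prems(2)[of r c] c by (simp add: mult.assoc[symmetric] scale_algebra)
    also have "\<dots> = scale (f r * g c * (prod f I * prod g (J - {c}))) (Z r c * minor Z I (J - {c}) * x)"
      by (simp add: IH scale_algebra mult.assoc)
    also have "f r * g c * (prod f I * prod g (J - {c})) = prod f (insert r I) * prod g J"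
      using r insert.hyps insert.prems(1) c by (simp add: prod.remove[of J c])
    finally show ?thesis .
  qed
  then show ?case
    using insert.hyps
    by (simp only: minor_insert_min row_op_def sum_distrib_left sum_distrib_right scale_sum_right)
      (intro sum.cong; simp add: scale_algebra mult.commute)
qed

text \<open>Laplace expansion along an arbitrary row: \<open>\<omega>\<^sub>r\<close> is moved to its place among the row forms, and
  gives zero if it occurs already.\<close>
lemma row_op_minor:
  assumes Z: "qmat p Z" and "finite I" "finite J"
  shows "row_op Z r (minor Z I) J =
    (if r \<in> I then 0 else scale ((-1) ^ n_below I r) (minor Z (insert r I) J))"
  using assms(2,3)
proof (induction I arbitrary: J rule: finite_linorder_min_induct)
  case empty
  then show ?case using minor_insert_min[of "{}" r Z] by (simp add: n_below_def)
next
  case (insert t I)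
  have t: "t \<notin> I" using insert.hyps by auto
  have step: "minor Z (insert t I) = row_op Z t (minor Z I)"
    using insert.hyps by (simp add: minor_insert_min)
  consider "r < t" | "r = t" | "t < r" by linarith
  then show ?case
  proof cases
    case 1
    then have "\<And>s. s \<in> insert t I \<Longrightarrow> r < s" using insert.hyps by force
    then show ?thesis
      using insert.hyps minor_insert_min[of "insert t I" r Z] n_below_none[of "insert t I" r]
      by (auto simp: less_imp_le)
  next
    case 2
    then show ?thesis using row_op_same[OF Z insert.prems] by (simp add: step)
  next
    case 3
    have "row_op Z r (minor Z (insert t I)) J = - row_op Z t (row_op Z r (minor Z I)) J"
      using row_op_anticommute[OF Z insert.prems 3] by (simp add: step)
    also have "row_op Z t (row_op Z r (minor Z I)) J = row_op Z t (\<lambda>J. if r \<in> I then 0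
        else scale ((-1) ^ n_below I r) (minor Z (insert r I) J)) J"
      using insert.IH insert.prems by (intro row_op_cong) simp
    also have "\<dots> = (if r \<in> I then 0 else scale ((-1) ^ n_below I r) (row_op Z t (minor Z (insert r I)) J))"
      by (simp add: row_op_0 row_op_scale)
    also have "row_op Z t (minor Z (insert r I)) = minor Z (insert t (insert r I))"
      using insert.hyps 3 by (intro minor_insert_min[symmetric]) auto
    finally show ?thesis
      using 3 t insert.hyps
      by (auto simp: n_below_insert(1) insert_commute)
  qed
qed

text \<open>Minors defined by row forms and by column forms agree. By induction on the rows, the expansion
  along the least row \<open>t\<close> yields the claim except for the term with \<open>z\<^sub>t\<^sub>b\<close>, which has to be moved
  past the complementary minor. This minor lies below and to the left of \<open>z\<^sub>t\<^sub>b\<close>, so only the relation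
  \<open>\<beta>\<gamma> = p \<gamma>\<beta>\<close> is involved.\<close>
lemma minor_insert_max_col:
  assumes Z: "qmat p Z" and "finite I" "finite K" "\<And>c. c \<in> K \<Longrightarrow> c < b"
  shows "minor Z I (insert b K) = col_op p Z b (\<lambda>I. minor Z I K) I"
  using assms(2-)
proof (induction I arbitrary: K rule: finite_linorder_min_induct)
  case empty
  then show ?case by (simp add: minor_empty col_op_def)
next
  case (insert t I)
  have t: "t \<notin> I" and b: "b \<notin> K" using insert by auto
  have step: "minor Z (insert t I) = row_op Z t (minor Z I)"
    using insert.hyps by (simp add: minor_insert_min)
  have main: "scale ((-1) ^ n_below (insert b K) c) (Z t c * minor Z I (insert b K - {c})) =
      (\<Sum>s\<in>I. scale ((-p) ^ n_above I s)
         (scale ((-1) ^ n_below K c) (Z t c * minor Z (I - {s}) (K - {c})) * Z s b))"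
    if c: "c \<in> K" for c
  proof -
    have "insert b K - {c} = insert b (K - {c})" using c b by auto
    moreover have "minor Z I (insert b (K - {c})) = col_op p Z b (\<lambda>I. minor Z I (K - {c})) I"
      using insert.prems by (intro insert.IH) auto
    moreover have "n_below (insert b K) c = n_below K c"
      using insert.prems c by (intro n_below_insert) (auto intro: less_imp_le)
    ultimately show ?thesis
      by (simp add: col_op_def sum_distrib_left scale_sum_right scale_algebra mult.assoc mult.commute)
  qed
  have tz: "minor Z (insert t (I - {s})) K = row_op Z t (minor Z (I - {s})) K" for s
    using insert.hyps by (intro fun_cong[OF minor_insert_min]) auto
  have last: "scale ((-1) ^ card K) (Z t b * minor Z I K) = scale ((-p) ^ card I) (minor Z I K * Z t b)"
  proof (cases "card I = card K")
    case True
    have "Z t b * minor Z I K = scale (prod (\<lambda>_. p) I * prod (\<lambda>_. 1) K) (minor Z I K * Z t b)"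
      using insert.hyps insert.prems qmat_anti[OF Z]
      by (intro commute_minor) auto
    then show ?thesis
      using True by (simp add: power_mult_distrib[symmetric])
  next
    case False
    then show ?thesis using minor_card_neq[of I K] insert by simp
  qed
  have "minor Z (insert t I) (insert b K) =
      (\<Sum>c\<in>K. \<Sum>s\<in>I. scale ((-p) ^ n_above I s)
         (scale ((-1) ^ n_below K c) (Z t c * minor Z (I - {s}) (K - {c})) * Z s b))
      + scale ((-1) ^ card K) (Z t b * minor Z I K)"
    using insert.prems b main n_below_all[of K b]
    by (simp add: step row_op_def n_below_insert add.commute cong: sum.cong)
  also have "(\<Sum>c\<in>K. \<Sum>s\<in>I. scale ((-p) ^ n_above I s)
         (scale ((-1) ^ n_below K c) (Z t c * minor Z (I - {s}) (K - {c})) * Z s b))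
      = (\<Sum>s\<in>I. scale ((-p) ^ n_above I s) (minor Z (insert t (I - {s})) K * Z s b))"
    by (subst sum.swap) (simp add: tz row_op_def scale_sum_right sum_distrib_right)
  also have "\<dots> = (\<Sum>s\<in>I. scale ((-p) ^ n_above (insert t I) s) (minor Z (insert t I - {s}) K * Z s b))"
  proof (intro sum.cong refl)
    fix s assume s: "s \<in> I"
    have "insert t I - {s} = insert t (I - {s})" using s t by auto
    moreover have "n_above (insert t I) s = n_above I s"
      using insert.hyps s by (intro n_above_insert) (auto intro: less_imp_le)
    ultimately show "scale ((-p) ^ n_above I s) (minor Z (insert t (I - {s})) K * Z s b)
        = scale ((-p) ^ n_above (insert t I) s) (minor Z (insert t I - {s}) K * Z s b)"
      by simp
  qed
  finally show ?case
    using insert.hyps t n_above_all[of I t]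
    by (simp add: last col_op_def n_above_insert add.commute)
qed

text \<open>Laplace expansion along an arbitrary column, with the entries on the right.\<close>
lemma col_op_minor:
  assumes Z: "qmat p Z" and "finite I" "finite J"
  shows "col_op p Z b (\<lambda>I. minor Z I J) I =
    (if b \<in> J then 0 else scale ((-p) ^ n_above J b) (minor Z I (insert b J)))"
  using assms(3,2)
proof (induction J arbitrary: I rule: finite_linorder_max_induct)
  case empty
  then show ?case using minor_insert_max_col[OF Z, of I "{}" b] by (simp add: n_above_def)
next
  case (insert c J)
  have c: "c \<notin> J" using insert.hyps by auto
  have step: "minor Z I (insert c J) = col_op p Z c (\<lambda>I. minor Z I J) I" if "finite I" for I
    using insert.hyps that by (intro minor_insert_max_col[OF Z]) auto
  have expand: "col_op p Z b (\<lambda>I. minor Z I (insert c J)) I = col_op p Z b (col_op p Z c (\<lambda>I. minor Z I J)) I"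
    using insert.prems by (intro col_op_cong step) auto
  consider "c < b" | "b = c" | "b < c" by linarith
  then show ?case
  proof cases
    case 1
    then have "\<And>s. s \<in> insert c J \<Longrightarrow> s < b" using insert.hyps by force
    then show ?thesis
      using insert.hyps insert.prems minor_insert_max_col[OF Z, of I "insert c J" b]
        n_above_none[of "insert c J" b]
      by (auto simp: less_imp_le)
  next
    case 2
    then show ?thesis using col_op_same[OF Z insert.prems] expand by simp
  next
    case 3
    have "col_op p Z b (\<lambda>I. minor Z I (insert c J)) I
        = scale (-p) (col_op p Z c (col_op p Z b (\<lambda>I. minor Z I J)) I)"
      unfolding expand by (rule col_op_anticommute[OF Z insert.prems 3])
    also have "col_op p Z c (col_op p Z b (\<lambda>I. minor Z I J)) I = col_op p Z c (\<lambda>I. if b \<in> J then 0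
        else scale ((-p) ^ n_above J b) (minor Z I (insert b J))) I"
      using insert.IH insert.prems by (intro col_op_cong) simp
    also have "\<dots> = (if b \<in> J then 0 else scale ((-p) ^ n_above J b) (col_op p Z c (\<lambda>I. minor Z I (insert b J)) I))"
      by (simp add: col_op_0 col_op_scale)
    also have "col_op p Z c (\<lambda>I. minor Z I (insert b J)) I = minor Z I (insert c (insert b J))"
      using insert.hyps insert.prems 3 by (intro minor_insert_max_col[OF Z, symmetric]) auto
    finally show ?thesis
      using 3 c insert.hyps
      by (auto simp: n_above_insert(1) insert_commute)
  qed
qed

end

section \<open>Commutation of minors\<close>

context complex_algebra
begin

text \<open>The double sum of \<open>z\<^sub>r\<^sub>c D\<^sub>s\<^sub>c z\<^sub>s\<^sub>b\<close>, summed over \<open>c\<close> first: the row \<open>r\<close> is repeated unless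
  \<open>s = r\<close>.\<close>
lemma entry_minor_sum:
  assumes Z: "qmat p Z" and "finite I" "finite J" "r \<in> I"
  shows "(\<Sum>c\<in>J. scale ((-1) ^ n_below J c) (Z r c * col_op p Z b (\<lambda>I. minor Z I (J - {c})) I))
    = scale ((-p) ^ n_above I r * (-1) ^ n_below I r) (minor Z I J * Z r b)"
proof -
  have "(\<Sum>c\<in>J. scale ((-1) ^ n_below J c) (Z r c * col_op p Z b (\<lambda>I. minor Z I (J - {c})) I))
    = (\<Sum>c\<in>J. \<Sum>s\<in>I. scale ((-p) ^ n_above I s)
        (scale ((-1) ^ n_below J c) (Z r c * minor Z (I - {s}) (J - {c})) * Z s b))"
    by (simp add: col_op_def sum_distrib_left scale_sum_right scale_algebra mult.assoc mult.commute)
  also have "\<dots> = (\<Sum>s\<in>I. scale ((-p) ^ n_above I s) (row_op Z r (minor Z (I - {s})) J * Z s b))"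
    by (subst sum.swap) (simp add: row_op_def scale_sum_right sum_distrib_right)
  also have "\<dots> = (\<Sum>s\<in>I. if s = r then
      scale ((-p) ^ n_above I r) (scale ((-1) ^ n_below I r) (minor Z I J) * Z r b) else 0)"
    using assms(2-4) by (intro sum.cong)
      (auto simp: row_op_minor[OF Z] insert_absorb n_below_remove)
  finally show ?thesis using assms(2,4) by (simp add: scale_algebra)
qed

text \<open>The same double sum, summed over \<open>s\<close> first: this replaces the column \<open>c\<close> of the minor by \<open>b\<close>. If
  \<open>b\<close> is one of the columns, only \<open>c = b\<close> survives. If \<open>b\<close> lies to the left or to the right of the
  interval, the replaced minors are all but one of the terms in an expansion along a repeated row with
  the columns \<open>J \<union> {b}\<close>, and this expansion is zero. For \<open>b\<close> in a gap of a set of columns the powers of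
  \<open>p\<close> would depend on \<open>c\<close>; this is where the interval is needed. The truncated subtraction and the
  minimum clamp \<open>b - j\<close> to the positions in the interval.\<close>
lemma minor_entry_sum_interval:
  fixes i j :: nat
  assumes Z: "qmat p Z" and r: "r < i"
  defines "I \<equiv> {..<i}" and "J \<equiv> {j..<j + i}"
  shows "(\<Sum>c\<in>J. scale ((-1) ^ n_below J c) (Z r c * col_op p Z b (\<lambda>I. minor Z I (J - {c})) I))
    = scale ((-1) ^ (i - 1) * p ^ (i - 1 - min (i - 1) (b - j))) (Z r b * minor Z I J)"
proof -
  have fin: "finite I" "finite J" and rI: "r \<in> I" and card: "card J = i"
    using r by (auto simp: I_def J_def)
  have F: "col_op p Z b (\<lambda>I. minor Z I (J - {c})) I = (if b \<in> J - {c} then 0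
      else scale ((-p) ^ n_above (J - {c}) b) (minor Z I (insert b (J - {c}))))" for c
    using fin by (intro col_op_minor[OF Z]) auto
  have row0: "row_op Z r (minor Z I) (insert b J) = 0"
    using row_op_minor[OF Z, of I "insert b J" r] fin rI by simp
  consider "b < j" | "b \<in> J" | "j + i \<le> b" by (cases "b < j"; cases "j + i \<le> b") (auto simp: J_def)
  then show ?thesis
  proof cases
    case 1
    then have b: "b \<notin> J" by (simp add: J_def)
    have sum: "(\<Sum>c\<in>J. scale ((-1) ^ n_below J c) (Z r c * minor Z I (insert b (J - {c}))))
      = Z r b * minor Z I J"
    proof -
      have "0 = scale ((-1) ^ n_below (insert b J) b) (Z r b * minor Z I J) +
          (\<Sum>c\<in>J. scale ((-1) ^ n_below (insert b J) c) (Z r c * minor Z I (insert b J - {c})))"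
        using fin b row0 by (simp add: row_op_def)
      also have "n_below (insert b J) b = 0"
        using 1 by (intro n_below_none) (auto simp: J_def)
      also have "(\<Sum>c\<in>J. scale ((-1) ^ n_below (insert b J) c) (Z r c * minor Z I (insert b J - {c})))
        = - (\<Sum>c\<in>J. scale ((-1) ^ n_below J c) (Z r c * minor Z I (insert b (J - {c}))))"
        unfolding sum_negf[symmetric]
      proof (rule sum.cong[OF refl])
        fix c assume c: "c \<in> J"
        then have "b < c" using 1 by (simp add: J_def)
        then have "n_below (insert b J) c = Suc (n_below J c)"
          using fin b by (intro n_below_insert)
        moreover have "insert b J - {c} = insert b (J - {c})" using c b by auto
        ultimately show "scale ((-1) ^ n_below (insert b J) c) (Z r c * minor Z I (insert b J - {c}))
          = - scale ((-1) ^ n_below J c) (Z r c * minor Z I (insert b (J - {c})))"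
          by simp
      qed
      finally show ?thesis by simp
    qed
    have "n_above (J - {c}) b = i - 1" if "c \<in> J" for c
      using 1 that card by (subst n_above_all) (auto simp: J_def)
    then have "(\<Sum>c\<in>J. scale ((-1) ^ n_below J c) (Z r c * col_op p Z b (\<lambda>I. minor Z I (J - {c})) I))
      = (\<Sum>c\<in>J. scale ((-p) ^ (i - 1)) (scale ((-1) ^ n_below J c) (Z r c * minor Z I (insert b (J - {c})))))"
      using b unfolding F by (intro sum.cong) (auto simp: scale_algebra mult.commute)
    also have "\<dots> = scale ((-p) ^ (i - 1)) (Z r b * minor Z I J)"
      by (simp only: scale_sum_right[symmetric] sum)
    finally show ?thesis using 1 by (simp add: power_mult_distrib[symmetric])
  next
    case 2
    have "(\<Sum>c\<in>J. scale ((-1) ^ n_below J c) (Z r c * col_op p Z b (\<lambda>I. minor Z I (J - {c})) I))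
      = (\<Sum>c\<in>J. if c = b then scale ((-1) ^ n_below J b * (-p) ^ n_above J b) (Z r b * minor Z I J) else 0)"
      using 2 unfolding F
      by (intro sum.cong) (auto simp: insert_absorb n_above_remove scale_algebra)
    also have "\<dots> = scale ((-1) ^ n_below J b * (-p) ^ n_above J b) (Z r b * minor Z I J)"
      using 2 fin by simp
    also have "n_below J b = b - j"
    proof -
      have "{d \<in> J. d < b} = {j..<b}" using 2 by (auto simp: J_def)
      then show ?thesis by (simp add: n_below_def)
    qed
    also have "n_above J b = j + i - 1 - b"
    proof -
      have "{d \<in> J. b < d} = {Suc b..<j + i}" using 2 by (auto simp: J_def)
      then show ?thesis by (simp add: n_above_def)
    qed
    also have "(-1) ^ (b - j) * (-p) ^ (j + i - 1 - b) = (-1) ^ (i - 1) * p ^ (i - 1 - min (i - 1) (b - j))"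
    proof -
      define t where "t = b - j"
      define u where "u = j + i - 1 - b"
      have "i - 1 = t + u" "i - 1 - min (i - 1) (b - j) = u"
        using 2 by (auto simp: J_def t_def u_def)
      then show ?thesis
        unfolding t_def[symmetric] u_def[symmetric] power_minus[of p u] by (simp add: power_add)
    qed
    finally show ?thesis .
  next
    case 3
    then have b: "b \<notin> J" by (simp add: J_def)
    have sum: "(\<Sum>c\<in>J. scale ((-1) ^ n_below J c) (Z r c * minor Z I (insert b (J - {c}))))
      = scale ((-1) ^ (i - 1)) (Z r b * minor Z I J)"
    proof -
      have "0 = scale ((-1) ^ n_below (insert b J) b) (Z r b * minor Z I J) +
          (\<Sum>c\<in>J. scale ((-1) ^ n_below (insert b J) c) (Z r c * minor Z I (insert b J - {c})))"
        using fin b row0 by (simp add: row_op_def)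
      also have "n_below (insert b J) b = Suc (i - 1)"
        using 3 r card n_below_all[of J b] n_below_insert(2)[of b b J] by (auto simp: J_def)
      also have "(\<Sum>c\<in>J. scale ((-1) ^ n_below (insert b J) c) (Z r c * minor Z I (insert b J - {c})))
        = (\<Sum>c\<in>J. scale ((-1) ^ n_below J c) (Z r c * minor Z I (insert b (J - {c}))))"
      proof (rule sum.cong[OF refl])
        fix c assume c: "c \<in> J"
        then have "c \<le> b" using 3 by (simp add: J_def)
        then have "n_below (insert b J) c = n_below J c" by (rule n_below_insert)
        moreover have "insert b J - {c} = insert b (J - {c})" using c b by auto
        ultimately show "scale ((-1) ^ n_below (insert b J) c) (Z r c * minor Z I (insert b J - {c}))
          = scale ((-1) ^ n_below J c) (Z r c * minor Z I (insert b (J - {c})))"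
          by simp
      qed
      finally show ?thesis by simp
    qed
    have "n_above (J - {c}) b = 0" for c
      using 3 by (intro n_above_none) (auto simp: J_def)
    then have "(\<Sum>c\<in>J. scale ((-1) ^ n_below J c) (Z r c * col_op p Z b (\<lambda>I. minor Z I (J - {c})) I))
      = (\<Sum>c\<in>J. scale ((-1) ^ n_below J c) (Z r c * minor Z I (insert b (J - {c}))))"
      using b unfolding F by (intro sum.cong) auto
    also note sum
    finally show ?thesis using 3 by simp
  qed
qed

text \<open>The comparison of both evaluations.\<close>
lemma minor_commute_entry:
  assumes Z: "qmat p Z" and p: "p \<noteq> 0" and r: "r < i"
  shows "minor Z {..<i} {j..<j + i} * Z r b =
    scale (p powi int r * p powi (- int (min (i - 1) (b - j)))) (Z r b * minor Z {..<i} {j..<j + i})"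
proof -
  let ?D = "minor Z {..<i} {j..<j + i}" and ?t = "min (i - 1) (b - j)"
  have 1: "n_below {..<i} r = r"
  proof -
    have "{d \<in> {..<i}. d < r} = {..<r}" using r by auto
    then show ?thesis by (simp add: n_below_def)
  qed
  have 2: "n_above {..<i} r = i - 1 - r"
  proof -
    have "{d \<in> {..<i}. r < d} = {Suc r..<i}" by auto
    then show ?thesis by (simp add: n_above_def)
  qed
  have "scale ((-p) ^ (i - 1 - r) * (-1) ^ r) (?D * Z r b) =
      scale ((-1) ^ (i - 1) * p ^ (i - 1 - ?t)) (Z r b * ?D)"
    using minor_entry_sum_interval[OF Z r, of j b] entry_minor_sum[OF Z, of "{..<i}" "{j..<j+i}" r b] r
    by (simp add: 1 2)
  also have "(-p) ^ (i - 1 - r) * (-1) ^ r = (-1) ^ (i - 1) * p ^ (i - 1 - r)"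
  proof -
    define u where "u = i - 1 - r"
    have "i - 1 = u + r" using r by (simp add: u_def)
    then show ?thesis
      unfolding u_def[symmetric] power_minus[of p u] by (simp add: power_add)
  qed
  finally have "scale ((-1) ^ (i - 1)) (scale (p ^ (i - 1 - r)) (?D * Z r b)) =
      scale ((-1) ^ (i - 1)) (scale (p ^ (i - 1 - ?t)) (Z r b * ?D))"
    by simp
  then have "scale (p ^ (i - 1 - r)) (?D * Z r b) = scale (p ^ (i - 1 - ?t)) (Z r b * ?D)"
    by (rule scale_cancel[THEN iffD1, rotated]) simp
  then have "scale (inverse (p ^ (i - 1 - r)) * p ^ (i - 1 - r)) (?D * Z r b) =
      scale (inverse (p ^ (i - 1 - r)) * p ^ (i - 1 - ?t)) (Z r b * ?D)"
    by (metis scale_scale)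
  then have "?D * Z r b = scale (inverse (p ^ (i - 1 - r)) * p ^ (i - 1 - ?t)) (Z r b * ?D)"
    using p by simp
  also have "inverse (p ^ (i - 1 - r)) * p ^ (i - 1 - ?t) = p powi int r * p powi (- int ?t)"
  proof -
    have "p ^ (i - 1 - ?t) * p ^ ?t = p ^ (i - 1 - r) * p ^ r"
      using r by (simp only: power_add[symmetric]) (simp add: min_def)
    then show ?thesis using p
      by (simp add: power_int_minus field_simps)
  qed
  finally show ?thesis .
qed

lemma prod_power_int:
  assumes "(p::complex) \<noteq> 0"
  shows "(\<Prod>x\<in>S. p powi f x) = p powi (\<Sum>x\<in>S. f x)"
proof (induction S rule: infinite_finite_induct)
  case (insert x S)
  then show ?case using assms by (simp add: power_int_add)
qed auto

lemma minor_commute_minor: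
  assumes Z: "qmat p Z" and p: "p \<noteq> 0" and "k \<le> i"
  shows "minor Z {..<i} {j..<j + i} * minor Z {..<k} {l..<l + k} =
    scale (p powi (\<Sum>r<k. int r - int (min (i - 1) (l + r - j))))
      (minor Z {..<k} {l..<l + k} * minor Z {..<i} {j..<j + i})"
proof -
  have "minor Z {..<i} {j..<j + i} * minor Z {..<k} {l..<l + k} =
    scale ((\<Prod>r<k. p powi int r) * (\<Prod>c\<in>{l..<l + k}. p powi (- int (min (i - 1) (c - j)))))
      (minor Z {..<k} {l..<l + k} * minor Z {..<i} {j..<j + i})"
    using assms(3) by (intro commute_minor minor_commute_entry[OF Z p]) auto
  also have "(\<Prod>c\<in>{l..<l + k}. p powi (- int (min (i - 1) (c - j))))
      = (\<Prod>r<k. p powi (- int (min (i - 1) (l + r - j))))"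
    using prod.shift_bounds_nat_ivl[of "\<lambda>c. p powi (- int (min (i - 1) (c - j)))" 0 l k]
    by (simp add: add.commute atLeast0LessThan)
  also have "(\<Prod>r<k. p powi int r) * (\<Prod>r<k. p powi (- int (min (i - 1) (l + r - j))))
      = p powi (\<Sum>r<k. int r - int (min (i - 1) (l + r - j)))"
    using p by (simp only: prod.distrib[symmetric] prod_power_int[OF p, symmetric]
        power_int_add[symmetric] diff_conv_add_uminus simp_thms)
  finally show ?thesis .
qed

end

text \<open>The substitution \<open>(m, n) \<mapsto> (m + n - 1 - l, l + 1 - n)\<close> identifies the first set in the
  definition of \<open>P\<close> with the part \<open>n > l - j\<close> of the second one. What remains is a
  triangle truncated by the sizes \<open>k\<close> and \<open>l - j\<close>.\<close>
lemma P_count_triangle: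
  assumes "j \<le> l"
  shows "P_count i j k l = - int (card {(m, n). 1 \<le> m \<and> m \<le> k \<and> 1 \<le> n \<and> n \<le> l - j \<and> m + n \<le> i})"
proof -
  let ?S1 = "{(m, n). l + 2 \<le> m + n \<and> m + n \<le> k + l + 1 \<and> 1 \<le> m \<and> m \<le> i \<and> 1 \<le> n \<and> n \<le> j}"
  let ?S2 = "{(m, n). 1 \<le> m + n \<and> m + n \<le> i \<and> 1 \<le> m \<and> m \<le> k \<and> 1 \<le> n \<and> n \<le> l}"
  let ?T = "{(m, n). 1 \<le> m \<and> m \<le> k \<and> 1 \<le> n \<and> n \<le> l - j \<and> m + n \<le> i}"
  let ?U = "{(m, n). l - j < n \<and> m + n \<le> i \<and> 1 \<le> m \<and> m \<le> k \<and> 1 \<le> n \<and> n \<le> l}"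
  have "bij_betw (\<lambda>(m, n). (m + n - 1 - l, l + 1 - n)) ?S1 ?U"
    by (rule bij_betwI[where g = "\<lambda>(m, n). (m + n, l + 1 - n)"]) (use assms in auto)
  then have "card ?S1 = card ?U" by (rule bij_betw_same_card)
  moreover have "?S2 = ?T \<union> ?U" using assms by auto
  moreover have "card (?T \<union> ?U) = card ?T + card ?U"
  proof (rule card_Un_disjoint)
    show "finite ?T" by (rule finite_subset[of _ "{..k} \<times> {..l}"]) auto
    show "finite ?U" by (rule finite_subset[of _ "{..k} \<times> {..l}"]) auto
  qed auto
  ultimately show ?thesis unfolding P_count_def by simp
qed

text \<open>For \<open>j = l\<close> the truncated triangle is empty and both exponents are zero.\<close>
lemma P_exp_antisym: "P_exp k l i j = - P_exp i j k l"
proof (cases "j = l")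
  case True
  have empty: "{(m, n). 1 \<le> m \<and> m \<le> k \<and> 1 \<le> n \<and> n \<le> l - l \<and> m + n \<le> i} = {}" for k i by auto
  have "P_count i l k l = 0" for i k
    unfolding P_count_triangle[OF order.refl] empty by simp
  then show ?thesis using True by (simp add: P_exp_def)
qed (auto simp: P_exp_def)

lemma card_triangle:
  "card {(m, n). 1 \<le> m \<and> m \<le> k \<and> 1 \<le> n \<and> n \<le> d \<and> m + n \<le> i} = (\<Sum>m\<in>{1..k}. min d (i - m))"
proof -
  have "{(m, n). 1 \<le> m \<and> m \<le> k \<and> 1 \<le> n \<and> n \<le> d \<and> m + n \<le> i} = (SIGMA m:{1..k}. {1..min d (i - m)})"
    by auto
  then show ?thesis by simp
qed

text \<open>The right-hand side is the exponent in \<open>minor_commute_minor\<close>: the truncated triangle is counted by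
  rows, and the summand with index \<open>r\<close> compares the position of the entry \<open>(r, l + r)\<close> with the
  diagonal of the larger minor.\<close>
lemma P_exp_eq_sum:
  assumes "k \<le> i"
  shows "P_exp i j k l = (\<Sum>r<k. int r - int (min (i - 1) (l + r - j)))"
proof (cases "j \<le> l")
  case True
  have "P_exp i j k l = - int (\<Sum>m\<in>{1..k}. min (l - j) (i - m))"
    unfolding P_exp_def P_count_triangle[OF True] card_triangle using True by simp
  also have "(\<Sum>m\<in>{1..k}. min (l - j) (i - m)) = (\<Sum>r<k. min (l - j) (i - Suc r))"
    by (rule sum.reindex_bij_witness[of _ Suc "\<lambda>m. m - 1"]) auto
  also have "- int \<dots> = (\<Sum>r<k. - int (min (l - j) (i - Suc r)))"
    by (simp add: sum_negf)
  also have "\<dots> = (\<Sum>r<k. int r - int (min (i - 1) (l + r - j)))"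
    using True assms by (intro sum.cong) auto
  finally show ?thesis .
next
  case False
  have "P_count k l i j =
      - int (card {(m, n). 1 \<le> m \<and> m \<le> i \<and> 1 \<le> n \<and> n \<le> j - l \<and> m + n \<le> k})"
    using False by (intro P_count_triangle) simp
  then have "P_exp i j k l =
      int (card {(m, n). 1 \<le> m \<and> m \<le> i \<and> 1 \<le> n \<and> n \<le> j - l \<and> m + n \<le> k})"
    using False by (simp add: P_exp_def)
  also have "{(m, n). 1 \<le> m \<and> m \<le> i \<and> 1 \<le> n \<and> n \<le> j - l \<and> m + n \<le> k}
      = {(m, n). 1 \<le> m \<and> m \<le> k \<and> 1 \<le> n \<and> n \<le> j - l \<and> m + n \<le> k}"
    using assms by auto
  also note card_triangle
  also have "(\<Sum>m\<in>{1..k}. min (j - l) (k - m)) = (\<Sum>r<k. min (j - l) r)"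
    by (rule sum.reindex_bij_witness[of _ "\<lambda>r. k - r" "\<lambda>m. k - m"]) auto
  also have "int \<dots> = (\<Sum>r<k. int r - int (min (i - 1) (l + r - j)))"
    using False assms unfolding of_nat_sum by (intro sum.cong) auto
  finally show ?thesis .
qed

section \<open>Adding a multiple of a column to its right neighbour\<close>

context complex_algebra
begin

text \<open>The relations of a \<open>GL\<^sub>q\<close> matrix separate into conditions on single columns and on pairs of
  columns. A column operation affects only few of them, and these one at a time.\<close>
definition col_ok :: "complex \<Rightarrow> (nat \<Rightarrow> 'a) \<Rightarrow> bool" where
  "col_ok p f \<longleftrightarrow> (\<forall>r s. r < s \<longrightarrow> f r * f s = scale p (f s * f r))"

definition pair_ok :: "complex \<Rightarrow> (nat \<Rightarrow> 'a) \<Rightarrow> (nat \<Rightarrow> 'a) \<Rightarrow> bool" where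
  "pair_ok p f g \<longleftrightarrow> (\<forall>r. f r * g r = g r * f r) \<and>
     (\<forall>r s. r < s \<longrightarrow> g r * f s = scale p (f s * g r) \<and>
        f r * g s - g r * f s = g s * f r - f s * g r)"

lemma qmat_iff_cols:
  "qmat p Z \<longleftrightarrow> (\<forall>a. col_ok p (\<lambda>r. Z r a)) \<and> (\<forall>a c. a < c \<longrightarrow> pair_ok p (\<lambda>r. Z r a) (\<lambda>r. Z r c))"
proof
  assume "qmat p Z"
  then show "(\<forall>a. col_ok p (\<lambda>r. Z r a)) \<and> (\<forall>a c. a < c \<longrightarrow> pair_ok p (\<lambda>r. Z r a) (\<lambda>r. Z r c))"
    unfolding qmat_def col_ok_def pair_ok_def by blast
next
  assume *: "(\<forall>a. col_ok p (\<lambda>r. Z r a)) \<and> (\<forall>a c. a < c \<longrightarrow> pair_ok p (\<lambda>r. Z r a) (\<lambda>r. Z r c))"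
  have "Z r a * Z r b = Z r b * Z r a" for r a b
    using * by (cases a b rule: linorder_cases) (auto simp: pair_ok_def)
  then show "qmat p Z"
    using * unfolding qmat_def col_ok_def pair_ok_def by blast
qed

text \<open>The conditions on pairs are linear in each column, and \<open>b\<close> can be pulled out to the right of every
  product. These are equivalences, since they serve both for building the product and for taking it
  apart.\<close>
lemma pair_ok_add_right:
  assumes "\<And>r. b * f r = f r * b" "pair_ok p f u"
  shows "pair_ok p f (\<lambda>r. w r + u r * b) \<longleftrightarrow> pair_ok p f w"
proof -
  have 1: "f r * (u s * b) = f r * u s * b" "u r * b * f s = u r * f s * b" for r s
    using assms(1)[of s] by (simp_all add: mult.assoc)
  have 2: "f r * (w r + u r * b) = (w r + u r * b) * f r \<longleftrightarrow> f r * w r = w r * f r" for r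
    using assms(2) by (simp add: pair_ok_def distrib_left distrib_right 1)
  have 3: "(w r + u r * b) * f s = scale p (f s * (w r + u r * b)) \<longleftrightarrow> w r * f s = scale p (f s * w r)"
    if "r < s" for r s
  proof -
    have "u r * f s = scale p (f s * u r)" using assms(2) that by (simp add: pair_ok_def)
    then show ?thesis by (simp add: distrib_left distrib_right scale_right_distrib 1 scale_algebra)
  qed
  have 4: "f r * (w s + u s * b) - (w r + u r * b) * f s = (w s + u s * b) * f r - f s * (w r + u r * b)
     \<longleftrightarrow> f r * w s - w r * f s = w s * f r - f s * w r"
    if "r < s" for r s
  proof -
    have "f r * u s - u r * f s = u s * f r - f s * u r"
      using assms(2) that unfolding pair_ok_def by blast
    then have "(f r * u s - u r * f s - (u s * f r - f s * u r)) * b = 0"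
      by (simp only: diff_self mult_zero_left)
    then have e: "f r * u s * b - u r * f s * b - (u s * f r * b - f s * u r * b) = 0"
      by (simp add: left_diff_distrib)
    have "f r * (w s + u s * b) - (w r + u r * b) * f s - ((w s + u s * b) * f r - f s * (w r + u r * b))
      = (f r * w s - w r * f s - (w s * f r - f s * w r))
        + (f r * u s * b - u r * f s * b - (u s * f r * b - f s * u r * b))"
      by (simp only: distrib_left distrib_right 1) (simp add: algebra_simps)
    then show ?thesis unfolding e add_0_right by (rule diff_eq_diff_eq)
  qed
  show ?thesis unfolding pair_ok_def using 2 3 4 by simp
qed

lemma pair_ok_add_left:
  assumes "\<And>r. b * g r = g r * b" "pair_ok p u g"
  shows "pair_ok p (\<lambda>r. w r + u r * b) g \<longleftrightarrow> pair_ok p w g"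
proof -
  have 1: "g r * (u s * b) = g r * u s * b" "u r * b * g s = u r * g s * b" for r s
    using assms(1)[of s] by (simp_all add: mult.assoc)
  have 2: "(w r + u r * b) * g r = g r * (w r + u r * b) \<longleftrightarrow> w r * g r = g r * w r" for r
    using assms(2) by (simp add: pair_ok_def distrib_left distrib_right 1)
  have 3: "g r * (w s + u s * b) = scale p ((w s + u s * b) * g r) \<longleftrightarrow> g r * w s = scale p (w s * g r)"
    if "r < s" for r s
  proof -
    have "g r * u s = scale p (u s * g r)" using assms(2) that by (simp add: pair_ok_def)
    then show ?thesis by (simp add: distrib_left distrib_right scale_right_distrib 1 scale_algebra)
  qed
  have 4: "(w r + u r * b) * g s - g r * (w s + u s * b) = g s * (w r + u r * b) - (w s + u s * b) * g r
     \<longleftrightarrow> w r * g s - g r * w s = g s * w r - w s * g r"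
    if "r < s" for r s
  proof -
    have "u r * g s - g r * u s = g s * u r - u s * g r"
      using assms(2) that unfolding pair_ok_def by blast
    then have "(u r * g s - g r * u s - (g s * u r - u s * g r)) * b = 0"
      by (simp only: diff_self mult_zero_left)
    then have e: "u r * g s * b - g r * u s * b - (g s * u r * b - u s * g r * b) = 0"
      by (simp add: left_diff_distrib)
    have "(w r + u r * b) * g s - g r * (w s + u s * b) - (g s * (w r + u r * b) - (w s + u s * b) * g r)
      = (w r * g s - g r * w s - (g s * w r - w s * g r))
        + (u r * g s * b - g r * u s * b - (g s * u r * b - u s * g r * b))"
      by (simp only: distrib_left distrib_right 1) (simp add: algebra_simps)
    then show ?thesis unfolding e add_0_right by (rule diff_eq_diff_eq)
  qed
  show ?thesis unfolding pair_ok_def using 2 3 4 by simp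
qed

lemma pair_ok_add_self:
  assumes "\<And>r. b * u r = u r * b" "col_ok p u"
  shows "pair_ok p u (\<lambda>r. w r + u r * b) \<longleftrightarrow> pair_ok p u w"
proof -
  have 1: "u r * (u s * b) = u r * u s * b" "u r * b * u s = u r * u s * b" for r s
    using assms(1)[of s] by (simp_all add: mult.assoc)
  have 2: "u r * (w r + u r * b) = (w r + u r * b) * u r \<longleftrightarrow> u r * w r = w r * u r" for r
    by (simp add: distrib_left distrib_right 1)
  have 3: "(w r + u r * b) * u s = scale p (u s * (w r + u r * b)) \<longleftrightarrow> w r * u s = scale p (u s * w r)"
    if "r < s" for r s
  proof -
    have "u r * u s = scale p (u s * u r)" using assms(2) that by (simp add: col_ok_def)
    then show ?thesis by (simp add: distrib_left distrib_right scale_right_distrib 1 scale_algebra)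
  qed
  have 4: "u r * (w s + u s * b) - (w r + u r * b) * u s = (w s + u s * b) * u r - u s * (w r + u r * b)
     \<longleftrightarrow> u r * w s - w r * u s = w s * u r - u s * w r" for r s
    by (simp add: distrib_left distrib_right 1)
  show ?thesis unfolding pair_ok_def using 2 3 4 by simp
qed

text \<open>The quadratic case, and the only place where the factor \<open>p\<close> in \<open>b w = p w b\<close> enters: with it, the
  terms linear in \<open>b\<close> are \<open>p\<close> times the difference of the two sides of \<open>\<alpha>\<delta> - \<beta>\<gamma> = \<delta>\<alpha> - \<gamma>\<beta>\<close>.\<close>
lemma col_ok_add:
  assumes "\<And>r. b * u r = u r * b" "\<And>r. b * w r = scale p (w r * b)" "col_ok p u" "pair_ok p u w"
  shows "col_ok p (\<lambda>r. w r + u r * b) \<longleftrightarrow> col_ok p w"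
proof -
  have "(w r + u r * b) * (w s + u s * b) = scale p ((w s + u s * b) * (w r + u r * b)) \<longleftrightarrow>
      w r * w s = scale p (w s * w r)" if rs: "r < s" for r s
  proof -
    have b: "u r * b * (w s + u s * b) = scale p (u r * w s * b) + u r * u s * b * b" for r s
      using assms(1,2)[of s] by (simp add: distrib_left mult.assoc scale_algebra)
        (simp add: mult.assoc[symmetric] assms(1))
    have u: "u r * u s = scale p (u s * u r)" using assms(3) rs by (simp add: col_ok_def)
    have wu: "w r * u s = scale p (u s * w r)"
      and "u r * w s - w r * u s = w s * u r - u s * w r"
      using assms(4) rs unfolding pair_ok_def by blast+
    then have "scale p (u r * w s - w r * u s - (w s * u r - u s * w r)) * b = 0"
      by (simp only: diff_self scale_zero_right mult_zero_left)
    then have e: "scale p (u r * w s * b) + w r * u s * b - scale p (w s * u r * b) - scale (p * p) (u s * w r * b) = 0"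
      by (simp add: wu algebra_simps scale_algebra)
    have "(w r + u r * b) * (w s + u s * b) - scale p ((w s + u s * b) * (w r + u r * b))
      = w r * w s - scale p (w s * w r)
       + (scale p (u r * w s * b) + w r * u s * b - scale p (w s * u r * b) - scale (p * p) (u s * w r * b))"
      unfolding distrib_right[of "w _"] b
      by (simp add: distrib_left scale_right_distrib u scale_algebra mult.assoc[symmetric])
    then show ?thesis unfolding e add_0_right by (rule diff_eq_diff_eq)
  qed
  then show ?thesis unfolding col_ok_def by simp
qed

text \<open>The operation changes the column \<open>m + 1\<close>, by \<open>b\<close> times column \<open>m\<close>.\<close>
definition add_col :: "nat \<Rightarrow> 'a \<Rightarrow> (nat \<Rightarrow> nat \<Rightarrow> 'a) \<Rightarrow> nat \<Rightarrow> nat \<Rightarrow> 'a" where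
  "add_col m b Z r c = (if c = Suc m then Z r (Suc m) + Z r m * b else Z r c)"

text \<open>The factor may depend on the column but not on the row. This is what a variable \<open>a\<^sub>m\<^sub>n\<close> satisfies
  with respect to the matrices before its use: the contributions of the factors in a product \<open>v\<^sub>r a\<^sub>r\<^sub>+\<^sub>1\<^sub>,\<^sub>s \<dots> a\<^sub>c\<^sub>,\<^sub>t\<close> telescope.\<close>
definition has_weight :: "'a \<Rightarrow> (nat \<Rightarrow> complex) \<Rightarrow> (nat \<Rightarrow> nat \<Rightarrow> 'a) \<Rightarrow> bool" where
  "has_weight x w Z \<longleftrightarrow> (\<forall>r c. x * Z r c = scale (w c) (Z r c * x))"

definition col_weight :: "complex \<Rightarrow> nat \<Rightarrow> nat \<Rightarrow> complex" where
  "col_weight p m c = (if c = m then p else 1)"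

lemma qcommute_add_mult:
  assumes "x * y = scale w (y * x)" "x * u = scale w' (u * x)" "x * b = scale (w / w') (b * x)" "w' \<noteq> 0"
  shows "x * (y + u * b) = scale w ((y + u * b) * x)"
proof -
  have "x * (u * b) = scale w' (u * (x * b))"
    using assms(2) by (simp add: mult.assoc[symmetric] scale_algebra)
  also have "\<dots> = scale w (u * b * x)"
    using assms(4) by (simp add: assms(3) scale_algebra mult.assoc)
  finally show ?thesis using assms(1) by (simp add: algebra_simps)
qed

lemma qmat_add_col_iff:
  assumes b: "has_weight b (col_weight p (Suc m)) Z"
  shows "qmat p (add_col m b Z) \<longleftrightarrow> qmat p Z"
proof -
  have bw: "b * Z r (Suc m) = scale p (Z r (Suc m) * b)" for r
    using b by (simp add: has_weight_def col_weight_def)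
  have bc: "b * Z r c = Z r c * b" if "c \<noteq> Suc m" for r c
    using b that by (simp add: has_weight_def col_weight_def)
  have old: "(\<lambda>r. add_col m b Z r c) = (\<lambda>r. Z r c)" if "c \<noteq> Suc m" for c
    using that by (simp add: add_col_def)
  have new: "(\<lambda>r. add_col m b Z r (Suc m)) = (\<lambda>r. Z r (Suc m) + Z r m * b)"
    by (simp add: add_col_def)
  have pairs: "pair_ok p (\<lambda>r. add_col m b Z r a) (\<lambda>r. add_col m b Z r c) \<longleftrightarrow>
      pair_ok p (\<lambda>r. Z r a) (\<lambda>r. Z r c)"
    if ac: "a < c" and colm: "col_ok p (\<lambda>r. Z r m)"
      and left: "\<And>a. a < m \<Longrightarrow> pair_ok p (\<lambda>r. Z r a) (\<lambda>r. Z r m)"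
      and right: "\<And>c. Suc m < c \<Longrightarrow> pair_ok p (\<lambda>r. Z r m) (\<lambda>r. Z r c)" for a c
  proof -
    consider "c = Suc m" "a = m" | "c = Suc m" "a < m" | "a = Suc m" | "a \<noteq> Suc m" "c \<noteq> Suc m"
      using ac by linarith
    then show ?thesis
    proof cases
      case 1
      then show ?thesis using pair_ok_add_self[OF bc colm] by (simp add: old new)
    next
      case 2
      then show ?thesis using pair_ok_add_right[OF bc left] by (simp add: old new)
    next
      case 3
      then show ?thesis using pair_ok_add_left[OF bc right] ac by (simp add: old new)
    next
      case 4
      then show ?thesis by (simp add: old)
    qed
  qed
  have cols: "col_ok p (\<lambda>r. add_col m b Z r c) \<longleftrightarrow> col_ok p (\<lambda>r. Z r c)"
    if "col_ok p (\<lambda>r. Z r m)" "pair_ok p (\<lambda>r. Z r m) (\<lambda>r. Z r (Suc m))" for c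
    using col_ok_add[OF bc bw that] by (cases "c = Suc m") (simp_all add: old new)
  show ?thesis
  proof
    assume *: "qmat p (add_col m b Z)"
    then have c: "col_ok p (\<lambda>r. add_col m b Z r a)"
      and pr: "a < c \<Longrightarrow> pair_ok p (\<lambda>r. add_col m b Z r a) (\<lambda>r. add_col m b Z r c)" for a c
      unfolding qmat_iff_cols by blast+
    have 1: "col_ok p (\<lambda>r. Z r m)"
      using c[of m] by (simp add: old)
    have 2: "pair_ok p (\<lambda>r. Z r a) (\<lambda>r. Z r m)" if "a < m" for a
      using pr[of a m] that by (simp add: old)
    have 3: "pair_ok p (\<lambda>r. Z r m) (\<lambda>r. Z r c)" if "Suc m < c" for c
      using pr[of m c] that by (simp add: old)
    have "pair_ok p (\<lambda>r. Z r a) (\<lambda>r. Z r c)" if "a < c" for a c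
      using pairs[OF that 1 2 3] * that by (simp add: qmat_iff_cols)
    then show "qmat p Z"
      using cols[OF 1] * by (simp add: qmat_iff_cols)
  next
    assume "qmat p Z"
    then show "qmat p (add_col m b Z)"
      using pairs cols by (simp add: qmat_iff_cols)
  qed
qed

text \<open>The converse of the idea behind \<open>qmat_add_col_iff\<close>: here the commutation of \<open>b\<close> with the entries is
  deduced from the relations after the operation. Row \<open>\<rho>\<close> contains the pivot \<open>u\<close> in column \<open>m\<close>. The
  entry of the changed matrix to its right is \<open>u b\<close>. If \<open>u b\<close> and \<open>u\<close> commute with an entry up to
  scalars, then so does \<open>b\<close>, up to the quotient of these. The zeros above and to
  the right of the pivot remove the correction terms of the relation
  \<open>\<alpha>\<delta> - \<beta>\<gamma> = \<delta>\<alpha> - \<gamma>\<beta>\<close>.\<close>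
lemma split_off_col:
  assumes Z: "qmat p (add_col m b Z)" and u: "invertible_elem (Z \<rho> m)"
    and zero: "\<And>k. k < \<rho> \<Longrightarrow> Z k m = 0" "\<And>k. k \<le> \<rho> \<Longrightarrow> Z k (Suc m) = 0"
      "\<And>k y. k \<le> \<rho> \<Longrightarrow> Suc m < y \<Longrightarrow> Z k y = 0"
  shows "has_weight b (col_weight p (Suc m)) Z"
proof -
  let ?Z = "add_col m b Z"
  obtain v where v: "v * Z \<rho> m = 1"
    using u by (auto simp: invertible_elem_def)
  have cancel: "x = y" if "Z \<rho> m * x = Z \<rho> m * y" for x y
    using arg_cong[OF that, of "\<lambda>x. v * x"] v by (simp add: mult.assoc[symmetric])
  have old: "?Z r c = Z r c" if "c \<noteq> Suc m" for r c
    using that by (simp add: add_col_def)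
  have new: "?Z r (Suc m) = Z r (Suc m) + Z r m * b" for r
    by (simp add: add_col_def)
  have piv: "?Z \<rho> (Suc m) = Z \<rho> m * b"
    using zero(2)[of \<rho>] by (simp add: new)
  have above: "?Z k (Suc m) = 0" if "k < \<rho>" for k
    using that zero(1,2)[of k] by (simp add: new)
  \<comment> \<open>Multiplied from the left by the pivot, the claim becomes a relation between entries.\<close>
  have reduce: "b * x = scale w (x * b)"
    if "?Z \<rho> (Suc m) * x = scale w' (x * ?Z \<rho> (Suc m))" "Z \<rho> m * x = scale w'' (x * Z \<rho> m)"
      "w' = w * w''" for x w w' w''
  proof (rule cancel)
    have "Z \<rho> m * (b * x) = scale w' (x * Z \<rho> m * b)"
      using that(1) by (simp add: piv mult.assoc)
    also have "\<dots> = scale w (scale w'' (x * Z \<rho> m) * b)"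
      by (simp add: that(3) scale_algebra)
    also have "\<dots> = Z \<rho> m * scale w (x * b)"
      by (simp add: that(2)[symmetric] scale_algebra mult.assoc)
    finally show "Z \<rho> m * (b * x) = Z \<rho> m * scale w (x * b)" .
  qed
  have left: "b * Z k c = Z k c * b" if c: "c < m" for k c
  proof -
    consider "k < \<rho>" | "k = \<rho>" | "\<rho> < k" by linarith
    then show ?thesis
    proof cases
      case 1
      have "Z k c * ?Z \<rho> (Suc m) = ?Z \<rho> (Suc m) * Z k c"
        using qmat_det[OF Z 1, of c "Suc m"] c by (simp add: old above[OF 1])
      moreover have "Z k c * Z \<rho> m = Z \<rho> m * Z k c"
        using qmat_det[OF Z 1 c] c zero(1)[OF 1] by (simp add: old)
      ultimately show ?thesis using reduce[of "Z k c" 1 1 1] by simp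
    next
      case 2
      then show ?thesis
        using reduce[of "Z k c" 1 1 1] qmat_row[OF Z, of \<rho> "Suc m" c] qmat_row[OF Z, of \<rho> m c] c
        by (simp add: old)
    next
      case 3
      then show ?thesis
        using reduce[of "Z k c" p p 1] qmat_anti[OF Z 3, of c "Suc m"] qmat_anti[OF Z 3, of c m] c
        by (simp add: old)
    qed
  qed
  have mid: "b * Z k m = Z k m * b" for k
  proof -
    consider "k < \<rho>" | "k = \<rho>" | "\<rho> < k" by linarith
    then show ?thesis
    proof cases
      case 1
      then show ?thesis using zero(1) by simp
    next
      case 2
      then show ?thesis
        using reduce[of "Z k m" 1 1 1] qmat_row[OF Z, of \<rho> "Suc m" m] by (simp add: old)
    next
      case 3
      then show ?thesis
        using reduce[of "Z k m" p p 1] qmat_anti[OF Z 3, of m "Suc m"] qmat_col[OF Z 3, of m]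
        by (simp add: old)
    qed
  qed
  have right: "b * Z k c = Z k c * b" if c: "Suc m < c" for k c
  proof (cases "k \<le> \<rho>")
    case True
    then show ?thesis using zero(3) c by simp
  next
    case False
    then have k: "\<rho> < k" by simp
    have "?Z \<rho> (Suc m) * Z k c = Z k c * ?Z \<rho> (Suc m)"
      using qmat_det[OF Z k c] zero(3)[of \<rho> c] c by (simp add: old)
    moreover have "Z \<rho> m * Z k c = Z k c * Z \<rho> m"
      using qmat_det[OF Z k, of m c] zero(3)[of \<rho> c] c by (simp add: old)
    ultimately show ?thesis using reduce[of "Z k c" 1 1 1] by simp
  qed
  have this_col: "b * Z k (Suc m) = scale p (Z k (Suc m) * b)" for k
  proof (cases "k \<le> \<rho>")
    case True
    then show ?thesis using zero(2) by simp
  next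
    case False
    then have k: "\<rho> < k" by simp
    define w where "w = ?Z \<rho> (Suc m)"
    define y where "y = ?Z k (Suc m)"
    define u where "u = Z \<rho> m"
    define t where "t = Z k m"
    have w: "w = u * b" by (simp add: w_def u_def piv)
    have z: "Z k (Suc m) = y - t * b" by (simp add: y_def t_def new)
    have 1: "w * y = scale p (y * w)" unfolding w_def y_def by (rule qmat_col[OF Z k])
    have 2: "w * t = scale p (t * w)"
      using qmat_anti[OF Z k, of m "Suc m"] by (simp add: w_def t_def old)
    have 3: "u * y = w * t + y * u - t * w"
      using qmat_det[OF Z k, of m "Suc m"] by (simp add: w_def y_def t_def u_def old algebra_simps)
    have 4: "u * t * b = w * t" using mid[of k] by (simp add: w t_def mult.assoc)
    have "u * scale p ((y - t * b) * b) = scale p (u * y * b) - scale p (u * t * b * b)"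
      by (simp add: algebra_simps scale_algebra mult.assoc)
    also have "\<dots> = scale p (y * w) - scale p (t * w) * b"
      unfolding 3 4 by (simp add: w algebra_simps scale_algebra mult.assoc)
    also have "\<dots> = u * (b * (y - t * b))"
      unfolding 1[symmetric] 2[symmetric] by (simp add: w algebra_simps)
    finally show ?thesis
      unfolding z u_def by (rule cancel[OF sym])
  qed
  show ?thesis
    unfolding has_weight_def col_weight_def
  proof (intro allI)
    fix r c
    show "b * Z r c = scale (if c = Suc m then p else 1) (Z r c * b)"
      using left[of c r] mid[of r] right[of c r] this_col[of r]
      by (cases c "Suc m" rule: linorder_cases) (auto simp: less_Suc_eq)
  qed
qed

end

section \<open>The relations between the factors\<close>

context complex_algebra
begin

lemma has_weight_zero: "has_weight 0 w Z"
  by (simp add: has_weight_def)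

lemma invertible_mult: "invertible_elem x \<Longrightarrow> invertible_elem y \<Longrightarrow> invertible_elem (x * (y :: 'a))"
proof -
  assume "invertible_elem x" "invertible_elem y"
  then obtain x' y' where "x * x' = 1" "x' * x = 1" "y * y' = 1" "y' * y = 1"
    by (auto simp: invertible_elem_def)
  moreover have "x * y * (y' * x') = x * (y * y') * x'" "y' * x' * (x * y) = y' * (x' * x) * y"
    by (simp_all only: mult.assoc)
  ultimately show ?thesis unfolding invertible_elem_def by (intro exI[of _ "y' * x'"]) simp
qed

lemma invertible_prod_list:
  "(\<And>x. x \<in> set xs \<Longrightarrow> invertible_elem x) \<Longrightarrow> invertible_elem (prod_list xs :: 'a)"
proof (induction xs)
  case Nil
  then show ?case by (auto simp: invertible_elem_def)
next
  case (Cons x xs)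
  then show ?case using invertible_mult[of x "prod_list xs"] by auto
qed

text \<open>The entries of \<open>T\<^sup>+ A\<^sub>1 \<cdots> A\<^sub>s\<close>, with rows and columns counted from zero. Multiplication by
  \<open>A\<^sub>s\<^sub>+\<^sub>1\<close> changes the columns \<open>c > s\<close>; no case distinction is needed for the others, where
  \<open>a\<^sub>c\<^sub>,\<^sub>s\<^sub>+\<^sub>1\<close> is taken to be zero.\<close>
primrec partial_prod :: "(nat \<Rightarrow> 'a) \<Rightarrow> (nat \<Rightarrow> nat \<Rightarrow> 'a) \<Rightarrow> nat \<Rightarrow> nat \<Rightarrow> nat \<Rightarrow> 'a" where
  "partial_prod v a 0 r c = (if r = c then v r else 0)"
| "partial_prod v a (Suc s) r c = partial_prod v a s r c + partial_prod v a s r (c - 1) * a c (Suc s)"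

text \<open>The state between \<open>T\<^sup>+ A\<^sub>1 \<cdots> A\<^sub>s\<close> and \<open>T\<^sup>+ A\<^sub>1 \<cdots> A\<^sub>s\<^sub>+\<^sub>1\<close> in which just the columns beyond \<open>m\<close> are
  changed already. The columns are processed from right to left, so that each one receives a multiple
  of its unchanged left neighbour.\<close>
definition stage :: "(nat \<Rightarrow> 'a) \<Rightarrow> (nat \<Rightarrow> nat \<Rightarrow> 'a) \<Rightarrow> nat \<Rightarrow> nat \<Rightarrow> nat \<Rightarrow> nat \<Rightarrow> 'a" where
  "stage v a s m r c = (if m < c then partial_prod v a (Suc s) r c else partial_prod v a s r c)"

lemma partial_prod_zero: "c < r \<or> r + s < c \<Longrightarrow> partial_prod v a s r c = 0"
  by (induction s arbitrary: c) force+

lemma partial_prod_top: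
  "partial_prod v a s r (r + s) = v r * (\<Prod>n\<leftarrow>[1..<s + 1]. a (r + n) n)"
proof (induction s)
  case (Suc s)
  then show ?case by (simp add: partial_prod_zero mult.assoc)
qed simp

lemma stage_step: "add_col m (a (Suc m) (Suc s)) (stage v a s (Suc m)) = stage v a s m"
  by (intro ext) (auto simp: add_col_def stage_def)

definition supported :: "nat \<Rightarrow> (nat \<Rightarrow> 'a) \<Rightarrow> (nat \<Rightarrow> nat \<Rightarrow> 'a) \<Rightarrow> bool" where
  "supported N v a \<longleftrightarrow> (\<forall>m\<ge>N. v m = 0) \<and> (\<forall>m n. \<not> (1 \<le> n \<and> n \<le> m \<and> m < N) \<longrightarrow> a m n = 0)"

lemma supportedD:
  assumes "supported N v a"
  shows "N \<le> m \<Longrightarrow> v m = 0" "n = 0 \<Longrightarrow> a m n = 0" "m < n \<Longrightarrow> a m n = 0" "N \<le> m \<Longrightarrow> a m n = 0"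
  using assms by (auto simp: supported_def)

lemma stage_first: "supported N v a \<Longrightarrow> stage v a s 0 = partial_prod v a (Suc s)"
  by (intro ext) (auto simp: stage_def supportedD)

lemma stage_last: "supported N v a \<Longrightarrow> stage v a s N = partial_prod v a s"
  by (intro ext) (auto simp: stage_def supportedD)

text \<open>The q-commutation relations, arranged by the order in which the variables are used: \<open>a\<^sub>m'\<^sub>n'\<close>
  precedes \<open>a\<^sub>m\<^sub>n\<close> if \<open>n' < n\<close>, or \<open>n' = n\<close> and \<open>m < m'\<close>. An element of weight \<open>w\<close> that commutes with
  the pivot and with its product with \<open>a\<^sub>m'\<^sub>n'\<close> commutes with \<open>a\<^sub>m'\<^sub>n'\<close> up to the quotient of the weights
  of columns \<open>m'\<close> and \<open>m' - 1\<close>.\<close>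
definition torus_relations :: "complex \<Rightarrow> (nat \<Rightarrow> 'a) \<Rightarrow> (nat \<Rightarrow> nat \<Rightarrow> 'a) \<Rightarrow> bool" where
  "torus_relations p v a \<longleftrightarrow>
     (\<forall>m m'. v m * v m' = v m' * v m) \<and>
     (\<forall>m n m'. a m n * v m' = scale (col_weight p m m') (v m' * a m n)) \<and>
     (\<forall>m n m' n'. n' < n \<or> n' = n \<and> m < m' \<longrightarrow>
        a m n * a m' n' = scale (col_weight p m m' / col_weight p m (m' - 1)) (a m' n' * a m n))"

lemma torus_relationsD:
  assumes "torus_relations p v a"
  shows "v m * v m' = v m' * v m"
    and "a m n * v m' = scale (col_weight p m m') (v m' * a m n)"
    and "n' < n \<or> n' = n \<and> m < m' \<Longrightarrow>
        a m n * a m' n' = scale (col_weight p m m' / col_weight p m (m' - 1)) (a m' n' * a m n)"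
  using assms unfolding torus_relations_def by blast+

lemma col_weight_nonzero: "p \<noteq> 0 \<Longrightarrow> col_weight p m c \<noteq> 0"
  by (simp add: col_weight_def)

lemma has_weight_partial_prod:
  assumes p: "p \<noteq> 0" and rel: "torus_relations p v a" and "s \<le> n"
  shows "has_weight (a m (Suc n)) (col_weight p m) (partial_prod v a s)"
  using assms(3)
proof (induction s)
  case 0
  then show ?case using torus_relationsD(2)[OF rel] by (auto simp: has_weight_def)
next
  case (Suc s)
  have "a m (Suc n) * partial_prod v a (Suc s) r c =
      scale (col_weight p m c) (partial_prod v a (Suc s) r c * a m (Suc n))" for r c
    unfolding partial_prod.simps
    using Suc torus_relationsD(3)[OF rel, of "Suc s" "Suc n" m c]
    by (intro qcommute_add_mult[where w' = "col_weight p m (c - 1)"])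
      (auto simp: has_weight_def col_weight_nonzero[OF p])
  then show ?case by (simp add: has_weight_def)
qed

lemma has_weight_stage:
  assumes p: "p \<noteq> 0" and rel: "torus_relations p v a"
  shows "has_weight (a m (Suc s)) (col_weight p m) (stage v a s m)"
proof -
  have w: "has_weight (a m (Suc s)) (col_weight p m) (partial_prod v a s)"
    by (rule has_weight_partial_prod[OF p rel]) simp
  have "a m (Suc s) * partial_prod v a (Suc s) r c =
      scale (col_weight p m c) (partial_prod v a (Suc s) r c * a m (Suc s))" if "m < c" for r c
    unfolding partial_prod.simps
    using w that torus_relationsD(3)[OF rel, of "Suc s" "Suc s" m c]
    by (intro qcommute_add_mult[where w' = "col_weight p m (c - 1)"])
      (auto simp: has_weight_def col_weight_nonzero[OF p])
  then show ?thesis using w by (auto simp: has_weight_def stage_def simp del: partial_prod.simps)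
qed

lemma qmat_partial_prod_0:
  "qmat p (partial_prod v a 0) \<longleftrightarrow> (\<forall>m m'. v m * v m' = v m' * v m)"
proof
  assume Z: "qmat p (partial_prod v a 0)"
  have less: "v m * v m' = v m' * v m" if "m < m'" for m m'
    using qmat_det[OF Z that that] that by simp
  show "\<forall>m m'. v m * v m' = v m' * v m"
  proof (intro allI)
    fix m m' show "v m * v m' = v m' * v m"
      using less[of m m'] less[of m' m] by (cases m m' rule: linorder_cases) auto
  qed
next
  assume "\<forall>m m'. v m * v m' = v m' * v m"
  then show "qmat p (partial_prod v a 0)" unfolding qmat_def by simp
qed

lemma torus_relations_imp_qmat:
  assumes p: "p \<noteq> 0" and rel: "torus_relations p v a" and supp: "supported N v a"
  shows "qmat p (partial_prod v a s)"
proof (induction s)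
  case 0
  show ?case using torus_relationsD(1)[OF rel] by (simp only: qmat_partial_prod_0) blast
next
  case (Suc s)
  have "qmat p (stage v a s (N - k))" for k
  proof (induction k)
    case 0
    show ?case using \<open>qmat p (partial_prod v a s)\<close> by (simp add: stage_last[OF supp])
  next
    case (Suc k)
    show ?case
    proof (cases "N - k")
      case 0
      then show ?thesis using Suc by simp
    next
      case (Suc m)
      have "qmat p (add_col m (a (Suc m) (Suc s)) (stage v a s (Suc m)))"
        using \<open>qmat p (stage v a s (N - k))\<close> Suc qmat_add_col_iff[OF has_weight_stage[OF p rel]] by simp
      moreover have "N - Suc k = m" using Suc by simp
      ultimately show ?thesis by (simp add: stage_step)
    qed
  qed
  from this[of N] show ?case by (simp add: stage_first[OF supp] del: partial_prod.simps)
qed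

definition variables_invertible :: "nat \<Rightarrow> (nat \<Rightarrow> 'a) \<Rightarrow> (nat \<Rightarrow> nat \<Rightarrow> 'a) \<Rightarrow> bool" where
  "variables_invertible N v a \<longleftrightarrow> (\<forall>m<N. invertible_elem (v m)) \<and>
     (\<forall>m n. 1 \<le> n \<and> n \<le> m \<and> m < N \<longrightarrow> invertible_elem (a m n))"

text \<open>The outermost nonzero diagonal of a partial product consists of monomials, and supplies the pivots.\<close>
lemma pivot_invertible:
  assumes "variables_invertible N v a" "r + s < N"
  shows "invertible_elem (partial_prod v a s r (r + s))"
  unfolding partial_prod_top using assms
  by (intro invertible_mult invertible_prod_list) (auto simp: variables_invertible_def)

lemma qmat_stage_back:
  assumes supp: "supported N v a" and inv: "variables_invertible N v a"
    and Z: "qmat p (stage v a s m)"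
  shows "has_weight (a (Suc m) (Suc s)) (col_weight p (Suc m)) (stage v a s (Suc m))"
    and "qmat p (stage v a s (Suc m))"
proof -
  show w: "has_weight (a (Suc m) (Suc s)) (col_weight p (Suc m)) (stage v a s (Suc m))"
  proof (cases "s \<le> m \<and> Suc m < N")
    case False
    then have "a (Suc m) (Suc s) = 0" using supportedD[OF supp] by auto
    then show ?thesis by (simp add: has_weight_zero)
  next
    case True
    define \<rho> where "\<rho> = m - s"
    have m: "m = \<rho> + s" using True by (simp add: \<rho>_def)
    show ?thesis
    proof (rule split_off_col[where \<rho> = \<rho>])
      show "qmat p (add_col m (a (Suc m) (Suc s)) (stage v a s (Suc m)))"
        using Z by (simp only: stage_step)
      show "invertible_elem (stage v a s (Suc m) \<rho> m)"
        using pivot_invertible[OF inv, of \<rho> s] True by (simp add: stage_def m)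
    qed (auto simp: stage_def m partial_prod_zero simp del: partial_prod.simps)
  qed
  show "qmat p (stage v a s (Suc m))"
    using Z qmat_add_col_iff[OF w] by (simp only: stage_step)
qed

lemma qmat_partial_prod_back:
  assumes supp: "supported N v a" and inv: "variables_invertible N v a"
    and Z: "qmat p (partial_prod v a (Suc s))"
  shows "has_weight (a m (Suc s)) (col_weight p m) (stage v a s m)"
    and "qmat p (partial_prod v a s)"
proof -
  have st: "qmat p (stage v a s m)" for m
  proof (induction m)
    case 0
    then show ?case using Z by (simp only: stage_first[OF supp])
  qed (rule qmat_stage_back[OF supp inv])
  show "has_weight (a m (Suc s)) (col_weight p m) (stage v a s m)"
    using qmat_stage_back(1)[OF supp inv st] supportedD(3)[OF supp]
    by (cases m) (auto simp: has_weight_zero)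
  show "qmat p (partial_prod v a s)"
    using st[of N] by (simp only: stage_last[OF supp])
qed

text \<open>Weights are inherited by the earlier stages, and on the way the commutation with the variables used
  in between is read off from the pivots. The induction is over the columns, from left to right, since
  a column of the earlier stage is recovered from its changed form and its left neighbour.\<close>
lemma has_weight_stage_back:
  assumes supp: "supported N v a" and inv: "variables_invertible N v a"
    and w: "\<And>c. w c \<noteq> 0" and x: "has_weight x w (stage v a s m)"
  shows "has_weight x w (partial_prod v a s)"
    and "m < c \<Longrightarrow> x * a c (Suc s) = scale (w c / w (c - 1)) (a c (Suc s) * x)"
proof -
  have "(\<forall>r. x * partial_prod v a s r c = scale (w c) (partial_prod v a s r c * x)) \<and>
      (m < c \<longrightarrow> x * a c (Suc s) = scale (w c / w (c - 1)) (a c (Suc s) * x))" for c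
  proof (induction c)
    case 0
    have "x * stage v a s m r 0 = scale (w 0) (stage v a s m r 0 * x)" for r
      using x by (simp add: has_weight_def)
    then show ?case by (simp add: stage_def)
  next
    case (Suc d)
    have st: "x * stage v a s m r (Suc d) = scale (w (Suc d)) (stage v a s m r (Suc d) * x)" for r
      using x by (simp add: has_weight_def)
    show ?case
    proof (cases "m < Suc d")
      case False
      then show ?thesis using st by (simp add: stage_def)
    next
      case True
      let ?b = "a (Suc d) (Suc s)"
      have b: "x * ?b = scale (w (Suc d) / w d) (?b * x)"
      proof (cases "s \<le> d \<and> Suc d < N")
        case False
        then have "?b = 0" using supportedD[OF supp] by auto
        then show ?thesis by simp
      next
        case range: True
        define \<rho> where "\<rho> = d - s"
        have d: "d = \<rho> + s" using range by (simp add: \<rho>_def)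
        let ?u = "partial_prod v a s \<rho> d"
        obtain u' where u': "u' * ?u = 1"
          using pivot_invertible[OF inv, of \<rho> s] range by (auto simp: d invertible_elem_def)
        have "stage v a s m \<rho> (Suc d) = ?u * ?b"
          using True by (simp add: stage_def partial_prod_zero d)
        then have "x * ?u * ?b = scale (w (Suc d)) (?u * ?b * x)"
          using st[of \<rho>] by (simp add: mult.assoc)
        moreover have "x * ?u = scale (w d) (?u * x)" using Suc by simp
        ultimately have eq: "scale (w d) (?u * (x * ?b)) = scale (w (Suc d)) (?u * (?b * x))"
          by (metis scale_mult_left mult.assoc)
        have "x * ?b = u' * ?u * (x * ?b)" by (simp only: u' mult_1_left)
        also have "\<dots> = u' * scale (inverse (w d)) (scale (w d) (?u * (x * ?b)))"
          using w[of d] by (simp add: mult.assoc)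
        also have "\<dots> = scale (w (Suc d) / w d) (u' * ?u * (?b * x))"
          unfolding eq by (simp add: scale_mult_right mult.assoc divide_inverse mult.commute[of "inverse (w d)"])
        finally show ?thesis by (simp only: u' mult_1_left)
      qed
      have "x * partial_prod v a s r (Suc d) = scale (w (Suc d)) (partial_prod v a s r (Suc d) * x)" for r
      proof -
        have "x * (partial_prod v a (Suc s) r (Suc d) + partial_prod v a s r d * (- ?b)) =
          scale (w (Suc d)) ((partial_prod v a (Suc s) r (Suc d) + partial_prod v a s r d * (- ?b)) * x)"
          using st[of r] True Suc b w
          by (intro qcommute_add_mult[where w' = "w d"]) (auto simp: stage_def)
        then show ?thesis by simp
      qed
      then show ?thesis using b by simp
    qed
  qed
  then show "has_weight x w (partial_prod v a s)"
    and "m < c \<Longrightarrow> x * a c (Suc s) = scale (w c / w (c - 1)) (a c (Suc s) * x)"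
    by (auto simp: has_weight_def)
qed

text \<open>All stages are \<open>GL\<^sub>q\<close> matrices, so each variable has the right weight at the stage where it is used.
  Going further back from there gives its relations with all variables used before it, and at the
  very beginning with the diagonal entries \<open>v\<^sub>m\<close>.\<close>
lemma qmat_imp_torus_relations:
  assumes p: "p \<noteq> 0" and supp: "supported N v a" and inv: "variables_invertible N v a"
    and Z: "qmat p (partial_prod v a (N - 1))"
  shows "torus_relations p v a"
proof -
  have qm: "qmat p (partial_prod v a (N - 1 - k))" for k
  proof (induction k)
    case 0
    then show ?case using Z by simp
  next
    case (Suc k)
    show ?case
    proof (cases "N - 1 - k")
      case 0
      then show ?thesis using Suc by simp
    next
      case (Suc s)
      moreover have "N - 1 - Suc k = s" using Suc by simp
      ultimately show ?thesis
        using \<open>qmat p (partial_prod v a (N - 1 - k))\<close> qmat_partial_prod_back(2)[OF supp inv] by simp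
    qed
  qed
  have stage: "has_weight (a m (Suc s)) (col_weight p m) (stage v a s m)" for m s
  proof (cases "Suc s \<le> N - 1")
    case True
    then show ?thesis
      using qmat_partial_prod_back(1)[OF supp inv] qm[of "N - 1 - Suc s"] by simp
  next
    case False
    then have "a m (Suc s) = 0" using supportedD(3,4)[OF supp, of m "Suc s"] supportedD(4)[OF supp, of m] by linarith
    then show ?thesis by (simp add: has_weight_zero)
  qed
  note recede = has_weight_stage_back[OF supp inv col_weight_nonzero[OF p]]
  have part: "has_weight (a m (Suc s)) (col_weight p m) (partial_prod v a (s - k))" for m s k
  proof (induction k)
    case 0
    then show ?case using recede(1)[OF stage] by simp
  next
    case (Suc k)
    show ?case
    proof (cases "s - k")
      case 0
      then show ?thesis using Suc by simp
    next
      case (Suc t)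
      then have "has_weight (a m (Suc s)) (col_weight p m) (stage v a t 0)"
        using \<open>has_weight (a m (Suc s)) (col_weight p m) (partial_prod v a (s - k))\<close>
        by (simp only: stage_first[OF supp])
      from recede(1)[OF this] Suc show ?thesis by (simp add: diff_Suc)
    qed
  qed
  have "v m * v m' = v m' * v m" for m m'
    using qm[of "N - 1"] qmat_partial_prod_0 by simp
  moreover have "a m n * v m' = scale (col_weight p m m') (v m' * a m n)" for m n m'
  proof (cases n)
    case 0
    then show ?thesis using supportedD(2)[OF supp] by simp
  next
    case (Suc s)
    have "has_weight (a m n) (col_weight p m) (partial_prod v a 0)"
      using part[of m s s] Suc by (simp only: diff_self_eq_0)
    then have "a m n * partial_prod v a 0 m' m' = scale (col_weight p m m') (partial_prod v a 0 m' m' * a m n)"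
      unfolding has_weight_def by blast
    then show ?thesis by simp
  qed
  moreover have "a m n * a m' n' = scale (col_weight p m m' / col_weight p m (m' - 1)) (a m' n' * a m n)"
    if later: "n' < n \<or> n' = n \<and> m < m'" for m n m' n'
  proof (cases "n' = 0 \<or> m' = 0")
    case True
    then have "a m' n' = 0" using supportedD(2,3)[OF supp] by (cases "n' = 0") auto
    then show ?thesis by simp
  next
    case False
    then obtain s' where n': "n' = Suc s'" by (cases n') auto
    obtain s where n: "n = Suc s" using later n' by (cases n) auto
    show ?thesis
    proof (cases "n' = n")
      case True
      then show ?thesis using recede(2)[OF stage, of m m' s] later n by simp
    next
      case neq: False
      then have "s - (s - Suc s') = Suc s'" using later n n' by simp
      then have "has_weight (a m (Suc s)) (col_weight p m) (stage v a s' 0)"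
        using part[of m s "s - Suc s'"] by (simp only: stage_first[OF supp])
      from recede(2)[OF this, of m'] show ?thesis using False n n' by simp
    qed
  qed
  ultimately show ?thesis unfolding torus_relations_def by blast
qed

end

section \<open>Minors of the product\<close>

context complex_algebra
begin

lemma commute_minor_simple:
  assumes "finite I" "finite J" "\<And>r c. r \<in> I \<Longrightarrow> c \<in> J \<Longrightarrow> x * Z r c = Z r c * x"
  shows "x * minor Z I J = minor Z I J * x"
  using commute_minor[OF assms(1,2), of x Z "\<lambda>_. 1" "\<lambda>_. 1"] assms(3) by simp

text \<open>A minor is additive in the changed column, and \<open>b\<close> can be moved to the far right because it
  commutes with all other columns. If column \<open>m\<close> is part of the minor as well, the additional terms
  cancel as for two equal columns.\<close>
lemma minor_add_col:
  assumes b: "\<And>r c. c \<noteq> Suc m \<Longrightarrow> b * Z r c = Z r c * b" and "finite I" "finite J"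
  shows "minor (add_col m b Z) I J = minor Z I J +
    (if Suc m \<in> J \<and> m \<notin> J then minor Z I (insert m (J - {Suc m})) * b else 0)"
  using assms(2,3)
proof (induction I arbitrary: J rule: finite_linorder_min_induct)
  case empty
  then show ?case by (auto simp: minor_empty)
next
  case (insert t I)
  let ?Z = "add_col m b Z"
  note unfold = minor_insert_min[OF insert.hyps(1)]
  have lt: "\<And>s. s \<in> I \<Longrightarrow> t < s" using insert.hyps by auto
  show ?case
  proof (cases "Suc m \<in> J")
    case False
    then have "row_op ?Z t (minor ?Z I) J = row_op Z t (minor Z I) J"
      unfolding row_op_def
    proof (intro sum.cong refl)
      fix c assume "c \<in> J"
      then have "?Z t c = Z t c" using False by (auto simp: add_col_def)
      moreover have "minor ?Z I (J - {c}) = minor Z I (J - {c})"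
        using insert.IH[of "J - {c}"] insert.prems False by simp
      ultimately show "scale ((-1) ^ n_below J c) (?Z t c * minor ?Z I (J - {c}))
          = scale ((-1) ^ n_below J c) (Z t c * minor Z I (J - {c}))" by simp
    qed
    then show ?thesis using False lt by (simp add: unfold)
  next
    case True
    define K where "K = J - {Suc m}"
    have J: "J = insert (Suc m) K" and K: "finite K" "Suc m \<notin> K"
      using True insert.prems by (auto simp: K_def)
    have bK: "b * minor Z I K = minor Z I K * b"
      using K insert.hyps by (intro commute_minor_simple b) auto
    have IH1: "minor ?Z I K = minor Z I K" using insert.IH[OF K(1)] K(2) by simp
    have pos: "n_below K (Suc m) = (if m \<in> K then Suc (n_below K m) else n_below K m)"
    proof (cases "m \<in> K")
      case True
      then show ?thesis
        using K by (simp add: n_below_def less_Suc_eq conj_disj_distribL Collect_disj_eq Collect_conv_if)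
    next
      case False
      then have "{d \<in> K. d < Suc m} = {d \<in> K. d < m}" by (auto simp: less_Suc_eq)
      then show ?thesis using False by (simp add: n_below_def)
    qed
    have "row_op ?Z t (minor ?Z I) J =
        scale ((-1) ^ n_below K (Suc m)) ((Z t (Suc m) + Z t m * b) * minor Z I K) +
        (\<Sum>c\<in>K. scale ((-1) ^ n_below J c) (Z t c * minor ?Z I (J - {c})))"
    proof -
      have "n_below J (Suc m) = n_below K (Suc m)" unfolding J by (rule n_below_insert) simp
      moreover have "J - {Suc m} = K" by (simp add: K_def)
      moreover have "(\<Sum>c\<in>K. scale ((-1) ^ n_below J c) (?Z t c * minor ?Z I (J - {c})))
        = (\<Sum>c\<in>K. scale ((-1) ^ n_below J c) (Z t c * minor ?Z I (J - {c})))"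
        using K by (intro sum.cong) (auto simp: add_col_def)
      ultimately show ?thesis
        using K IH1 unfolding row_op_def by (subst (1) J) (simp add: add_col_def)
    qed
    also have "scale ((-1) ^ n_below K (Suc m)) ((Z t (Suc m) + Z t m * b) * minor Z I K)
        = scale ((-1) ^ n_below K (Suc m)) (Z t (Suc m) * minor Z I K)
          + scale ((-1) ^ n_below K (Suc m)) (Z t m * minor Z I K) * b"
      using bK by (simp add: distrib_right scale_right_distrib mult.assoc scale_mult_left)
    finally have expand: "row_op ?Z t (minor ?Z I) J =
        scale ((-1) ^ n_below K (Suc m)) (Z t (Suc m) * minor Z I K)
        + scale ((-1) ^ n_below K (Suc m)) (Z t m * minor Z I K) * b
        + (\<Sum>c\<in>K. scale ((-1) ^ n_below J c) (Z t c * minor ?Z I (J - {c})))" .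
    have expand': "row_op Z t (minor Z I) J =
        scale ((-1) ^ n_below K (Suc m)) (Z t (Suc m) * minor Z I K)
        + (\<Sum>c\<in>K. scale ((-1) ^ n_below J c) (Z t c * minor Z I (J - {c})))"
    proof -
      have "n_below J (Suc m) = n_below K (Suc m)" unfolding J by (rule n_below_insert) simp
      moreover have "J - {Suc m} = K" by (simp add: K_def)
      ultimately show ?thesis
        using K unfolding row_op_def by (subst (1) J) simp
    qed
    show ?thesis
    proof (cases "m \<in> J")
      case m: True
      then have mK: "m \<in> K" by (simp add: K_def)
      have "minor ?Z I (J - {c}) = minor Z I (J - {c}) + (if c = m then minor Z I K * b else 0)"
        if "c \<in> K" for c
      proof (cases "c = m")
        case True
        have "insert m (J - {m} - {Suc m}) = K" using mK by (auto simp: K_def)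
        then show ?thesis using insert.IH[of "J - {m}"] insert.prems \<open>Suc m \<in> J\<close> True by simp
      next
        case False
        then show ?thesis using insert.IH[of "J - {c}"] insert.prems m by simp
      qed
      then have "(\<Sum>c\<in>K. scale ((-1) ^ n_below J c) (Z t c * minor ?Z I (J - {c})))
        = (\<Sum>c\<in>K. scale ((-1) ^ n_below J c) (Z t c * minor Z I (J - {c}))
            + (if c = m then scale ((-1) ^ n_below J m) (Z t m * minor Z I K) * b else 0))"
        by (intro sum.cong refl) (simp add: distrib_left scale_right_distrib scale_mult_left mult.assoc)
      also have "\<dots> = (\<Sum>c\<in>K. scale ((-1) ^ n_below J c) (Z t c * minor Z I (J - {c})))
            + scale ((-1) ^ n_below J m) (Z t m * minor Z I K) * b"
        using K mK by (simp add: sum.distrib)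
      also have "n_below J m = n_below K m" unfolding J by (rule n_below_insert) simp
      finally show ?thesis
        using lt m mK by (simp add: unfold expand expand' pos)
    next
      case m: False
      then have mK: "m \<notin> K" by (simp add: K_def)
      have "minor ?Z I (J - {c}) = minor Z I (J - {c}) + minor Z I (insert m K - {c}) * b"
        if "c \<in> K" for c
      proof -
        have "insert m (J - {c} - {Suc m}) = insert m K - {c}" using mK that by (auto simp: K_def)
        then show ?thesis using insert.IH[of "J - {c}"] insert.prems m \<open>Suc m \<in> J\<close> K(2) that by auto
      qed
      moreover have "n_below J c = n_below (insert m K) c" if "c \<in> K" for c
      proof (cases "c < m")
        case True
        then show ?thesis unfolding J by (simp add: n_below_insert(2))
      next
        case False
        moreover have "c \<noteq> m" "c \<noteq> Suc m" using that mK K(2) by auto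
        ultimately have "Suc m < c" by simp
        then show ?thesis unfolding J using K mK by (simp add: n_below_insert(1))
      qed
      ultimately have "(\<Sum>c\<in>K. scale ((-1) ^ n_below J c) (Z t c * minor ?Z I (J - {c})))
        = (\<Sum>c\<in>K. scale ((-1) ^ n_below J c) (Z t c * minor Z I (J - {c})))
          + (\<Sum>c\<in>K. scale ((-1) ^ n_below (insert m K) c) (Z t c * minor Z I (insert m K - {c}))) * b"
        by (simp add: sum.distrib[symmetric] sum_distrib_right distrib_left scale_right_distrib
            scale_mult_left mult.assoc)
      moreover have "row_op Z t (minor Z I) (insert m K) =
          scale ((-1) ^ n_below K (Suc m)) (Z t m * minor Z I K)
          + (\<Sum>c\<in>K. scale ((-1) ^ n_below (insert m K) c) (Z t c * minor Z I (insert m K - {c})))"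
        using K mK pos by (simp add: row_op_def n_below_insert(2))
      ultimately show ?thesis
        using lt m \<open>Suc m \<in> J\<close> by (simp add: unfold expand expand' K_def[symmetric] distrib_right)
    qed
  qed
qed

text \<open>The factor \<open>A\<^sub>s\<^sub>+\<^sub>1\<close> with \<open>s \<ge> j\<close> changes only columns beyond \<open>j\<close>, whose left neighbours belong to
  the interval along with them.\<close>
lemma minor_partial_prod_Suc:
  assumes p: "p \<noteq> 0" and rel: "torus_relations p v a" and supp: "supported N v a"
    and "j \<le> s" "finite I"
  shows "minor (partial_prod v a (Suc s)) I {j..<k} = minor (partial_prod v a s) I {j..<k}"
proof -
  have step: "minor (stage v a s m) I {j..<k} = minor (stage v a s (Suc m)) I {j..<k}" for m
  proof (cases "m < s")
    case True
    then have "a (Suc m) (Suc s) = 0" using supportedD(3)[OF supp] by simp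
    moreover have "add_col m 0 Z = Z" for Z by (intro ext) (simp add: add_col_def)
    ultimately show ?thesis using stage_step[of m a s v] by simp
  next
    case False
    have "minor (add_col m (a (Suc m) (Suc s)) (stage v a s (Suc m))) I {j..<k}
        = minor (stage v a s (Suc m)) I {j..<k}"
      using has_weight_stage[OF p rel, of "Suc m" s] False assms(4,5)
      by (subst minor_add_col) (auto simp: has_weight_def col_weight_def)
    then show ?thesis by (simp only: stage_step)
  qed
  have "minor (stage v a s 0) I {j..<k} = minor (stage v a s m) I {j..<k}" for m
    by (induction m) (simp_all only: step[symmetric])
  from this[of N] show ?thesis by (simp only: stage_first[OF supp] stage_last[OF supp])
qed

lemma minor_partial_prod:
  assumes "p \<noteq> 0" "torus_relations p v a" "supported N v a" "finite I"
  shows "minor (partial_prod v a (j + t)) I {j..<k} = minor (partial_prod v a j) I {j..<k}"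
proof (induction t)
  case (Suc t)
  then show ?case using minor_partial_prod_Suc[OF assms(1-3) _ assms(4), of j "j + t" k]
    by (simp del: partial_prod.simps)
qed simp

lemma minor_triangular:
  assumes "\<And>r c. r + j < c \<Longrightarrow> Z r c = 0"
  shows "minor Z {k..<k + n} {k + j..<k + j + n} = (\<Prod>r\<leftarrow>[k..<k + n]. Z r (r + j))"
proof (induction n arbitrary: k)
  case 0
  then show ?case by (simp add: minor_empty)
next
  case (Suc n)
  let ?J = "{k + j..<k + j + Suc n}"
  have rows: "{k..<k + Suc n} = insert k {Suc k..<Suc k + n}" by auto
  have cols: "?J - {k + j} = {Suc k + j..<Suc k + j + n}" by auto
  have "minor Z {k..<k + Suc n} ?J = row_op Z k (minor Z {Suc k..<Suc k + n}) ?J"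
    unfolding rows by (subst minor_insert_min) auto
  also have "\<dots> = (\<Sum>c\<in>?J. if c = k + j then Z k (k + j) * minor Z {Suc k..<Suc k + n} (?J - {k + j}) else 0)"
    unfolding row_op_def
  proof (intro sum.cong refl)
    fix c assume c: "c \<in> ?J"
    have "n_below ?J (k + j) = 0" by (rule n_below_none) simp
    then show "scale ((-1) ^ n_below ?J c) (Z k c * minor Z {Suc k..<Suc k + n} (?J - {c}))
      = (if c = k + j then Z k (k + j) * minor Z {Suc k..<Suc k + n} (?J - {k + j}) else 0)"
      using c assms[of k c] by auto
  qed
  also have "\<dots> = Z k (k + j) * minor Z {Suc k..<Suc k + n} (?J - {k + j})"
    by simp
  also have "\<dots> = Z k (k + j) * (\<Prod>r\<leftarrow>[Suc k..<Suc k + n]. Z r (r + j))"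
    unfolding cols Suc.IH ..
  also have "\<dots> = (\<Prod>r\<leftarrow>[k..<k + Suc n]. Z r (r + j))"
    by (subst (2) upt_conv_Cons) auto
  finally show ?case .
qed

lemma commute_prod_list:
  "(\<And>y. y \<in> set ys \<Longrightarrow> x * y = y * (x :: 'a)) \<Longrightarrow> x * prod_list ys = prod_list ys * x"
proof (induction ys)
  case (Cons y ys)
  have "x * (y * prod_list ys) = y * (x * prod_list ys)"
    using Cons.prems[of y] by (simp add: mult.assoc[symmetric])
  then show ?case using Cons by (simp add: mult.assoc)
qed simp

lemma monomial_reorder:
  assumes rel: "torus_relations p v a" and v0: "v 0 = 1"
  shows "(\<Prod>r\<leftarrow>[0..<i]. v r * (\<Prod>n\<leftarrow>[1..<j + 1]. a (r + n) n)) =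
    (\<Prod>m\<leftarrow>[1..<i + 1]. \<Prod>n\<leftarrow>[1..<j + 1]. a (m + n - 1) n) * (\<Prod>k\<leftarrow>[1..<i]. v k)"
proof (induction i)
  case (Suc i)
  let ?x = "\<Prod>n\<leftarrow>[1..<j + 1]. a (i + n) n"
  have comm: "v k * ?x = ?x * v k" if "k \<le> i" for k
    using torus_relationsD(2)[OF rel, of "i + n" n k for n] that
    by (intro commute_prod_list) (auto simp: col_weight_def)
  let ?L = "\<Prod>m\<leftarrow>[1..<i + 1]. \<Prod>n\<leftarrow>[1..<j + 1]. a (m + n - 1) n"
  let ?V = "\<Prod>k\<leftarrow>[1..<i]. v k"
  have "?x * ?V = ?V * ?x"
    using comm by (intro commute_prod_list) auto
  then have V: "?V * (v i * ?x) = ?x * (?V * v i)"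
    using comm[of i] by (simp only: mult.assoc[symmetric] order_refl)
  have Vi: "(\<Prod>k\<leftarrow>[1..<Suc i]. v k) = ?V * v i"
    using v0 by (cases "i = 0") simp_all
  have "(\<Prod>r\<leftarrow>[0..<Suc i]. v r * (\<Prod>n\<leftarrow>[1..<j + 1]. a (r + n) n)) = ?L * ?V * (v i * ?x)"
    unfolding Suc.IH[symmetric] by (simp del: upt_Suc add: upt_Suc_append)
  also have "\<dots> = ?L * ?x * (?V * v i)"
    using V by (simp only: mult.assoc)
  also have "?L * ?x = (\<Prod>m\<leftarrow>[1..<Suc i + 1]. \<Prod>n\<leftarrow>[1..<j + 1]. a (m + n - 1) n)"
  proof -
    have "[1..<Suc i + 1] = [1..<i + 1] @ [i + 1]" by simp
    then show ?thesis by (simp del: upt_Suc)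
  qed
  finally show ?case by (simp only: Vi)
qed simp

lemma minor_monomial:
  assumes "p \<noteq> 0" "torus_relations p v a" "supported N v a" "v 0 = 1" "j \<le> s"
  shows "minor (partial_prod v a s) {..<i} {j..<j + i} =
    (\<Prod>m\<leftarrow>[1..<i + 1]. \<Prod>n\<leftarrow>[1..<j + 1]. a (m + n - 1) n) * (\<Prod>k\<leftarrow>[1..<i]. v k)"
proof -
  have "minor (partial_prod v a s) {..<i} {j..<j + i} = minor (partial_prod v a j) {0..<0 + i} {0 + j..<0 + j + i}"
    using minor_partial_prod[OF assms(1-3), of "{..<i}" j "s - j" "j + i"] assms(5)
    by (simp add: atLeast0LessThan)
  also have "\<dots> = (\<Prod>r\<leftarrow>[0..<0 + i]. partial_prod v a j r (r + j))"
    by (rule minor_triangular) (simp add: partial_prod_zero)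
  also have "\<dots> = (\<Prod>r\<leftarrow>[0..<i]. v r * (\<Prod>n\<leftarrow>[1..<j + 1]. a (r + n) n))"
    by (simp only: partial_prod_top add_0)
  also note monomial_reorder[OF assms(2,4)]
  finally show ?thesis .
qed

end

section \<open>From functions to matrices\<close>

context complex_algebra
begin

lemma scale_minus_one_power: "scale ((-1) ^ n) x = (-1) ^ n * x"
  by (induction n) (simp_all add: scale_minus_left)

lemma sum_permutations_Suc:
  "(\<Sum>p | p permutes {0..<Suc n}. h p) =
   (\<Sum>j\<in>{0..<Suc n}. \<Sum>p | p permutes {0..<n}. h (permutation_insert 0 j p))"
proof -
  let ?P = "{p. p permutes {0..<Suc n}}"
  have range: "(\<lambda>p. p 0) ` ?P \<subseteq> {0..<Suc n}"
  proof clarify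
    fix p :: "nat \<Rightarrow> nat" assume "p permutes {0..<Suc n}"
    then show "p 0 \<in> {0..<Suc n}" using permutes_in_image[of p "{0..<Suc n}" 0] by simp
  qed
  have "sum h ?P = (\<Sum>j\<in>{0..<Suc n}. sum h {p \<in> ?P. p 0 = j})"
    using sum.group[OF finite_permutations[of "{0..<Suc n}"] _ range, of h] by simp
  also have "\<dots> = (\<Sum>j\<in>{0..<Suc n}. \<Sum>p | p permutes {0..<n}. h (permutation_insert 0 j p))"
  proof (rule sum.cong[OF refl])
    fix j assume "j \<in> {0..<Suc n}"
    then have j: "j < Suc n" by simp
    have "{p \<in> ?P. p 0 = j} = permutation_insert 0 j ` {p. p permutes {0..<n}}"
      using permutation_fix[of 0 n j] j by simp
    then show "sum h {p \<in> ?P. p 0 = j} = (\<Sum>p | p permutes {0..<n}. h (permutation_insert 0 j p))"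
      using sum.reindex[OF permutation_insert_inj_on[of 0 n j], of h] j by simp
  qed
  finally show ?thesis .
qed

text \<open>The sum over all permutations satisfies the expansion along the first row: the permutations are
  grouped by the image of \<open>0\<close>. The function \<open>g\<close> enumerates the columns.\<close>
lemma sum_permutations_minor:
  assumes "strict_mono g"
  shows "(\<Sum>p | p permutes {0..<n}. of_int (sign p) * (\<Prod>r\<leftarrow>[0..<n]. Z (k + r) (g (p r)))) =
    minor Z {k..<k + n} (g ` {0..<n})"
  using assms
proof (induction n arbitrary: k g)
  case 0
  have "{p. p permutes ({} :: nat set)} = {id}" by auto
  then show ?case by (simp add: minor_empty sign_id)
next
  case (Suc n)
  let ?J = "g ` {0..<Suc n}"
  have rows: "{k..<k + Suc n} = insert k {Suc k..<Suc k + n}" by auto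
  have inj: "inj_on g S" for S using Suc.prems by (meson strict_mono_imp_inj_on inj_on_subset subset_UNIV)
  have summand: "(\<Sum>p | p permutes {0..<n}. of_int (sign (permutation_insert 0 j p)) *
        (\<Prod>r\<leftarrow>[0..<Suc n]. Z (k + r) (g (permutation_insert 0 j p r))))
      = scale ((-1) ^ n_below ?J (g j)) (Z k (g j) * minor Z {Suc k..<Suc k + n} (?J - {g j}))"
    if "j < Suc n" for j
  proof -
    define g' where "g' = g \<circ> insert_index j"
    have mono: "strict_mono g'"
      using Suc.prems by (auto simp: g'_def strict_mono_def insert_index_def)
    have "insert_index j ` {0..<n} = {0..<Suc n} - {j}"
      using that by (simp add: insert_index_image)
    then have "g' ` {0..<n} = g ` ({0..<Suc n} - {j})"
      by (simp only: g'_def image_comp[symmetric])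
    then have img: "g' ` {0..<n} = ?J - {g j}"
      by (simp only: image_set_diff[OF inj] image_insert image_empty)
    have below: "n_below ?J (g j) = j"
    proof -
      have "{d \<in> ?J. d < g j} = g ` {0..<j}"
        using that Suc.prems by (auto simp: strict_mono_less)
      then show ?thesis using inj by (simp add: n_below_def card_image)
    qed
    have shift: "[0..<Suc n] = 0 # map Suc [0..<n]"
      by (simp only: map_Suc_upt) (simp add: upt_conv_Cons)
    have entry: "g (permutation_insert 0 j p (Suc r)) = g' (p r)" for p r
      by (simp add: g'_def permutation_insert_expand insert_index_def)
    have "(\<Sum>p | p permutes {0..<n}. of_int (sign (permutation_insert 0 j p)) *
        (\<Prod>r\<leftarrow>[0..<Suc n]. Z (k + r) (g (permutation_insert 0 j p r))))
      = (\<Sum>p | p permutes {0..<n}. (-1) ^ j * (Z k (g j) *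
          (of_int (sign p) * (\<Prod>r\<leftarrow>[0..<n]. Z (Suc k + r) (g' (p r))))))"
    proof (intro sum.cong refl)
      fix p assume "p \<in> {p. p permutes {0..<n}}"
      then have "of_int (sign (permutation_insert 0 j p)) = (-1) ^ j * (of_int (sign p) :: 'a)"
        using signof_permutation_insert[of p n 0 j, where 'a = 'a] that by simp
      moreover have "(\<Prod>r\<leftarrow>[0..<Suc n]. Z (k + r) (g (permutation_insert 0 j p r)))
          = Z k (g j) * (\<Prod>r\<leftarrow>[0..<n]. Z (Suc k + r) (g' (p r)))"
        unfolding shift by (simp add: o_def entry del: upt_Suc)
      moreover have "of_int (sign p) * (Z k (g j) * x) = Z k (g j) * (of_int (sign p) * x)" for x
        by (metis mult.assoc mult_of_int_commute)
      ultimately show "of_int (sign (permutation_insert 0 j p)) *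
        (\<Prod>r\<leftarrow>[0..<Suc n]. Z (k + r) (g (permutation_insert 0 j p r)))
        = (-1) ^ j * (Z k (g j) * (of_int (sign p) * (\<Prod>r\<leftarrow>[0..<n]. Z (Suc k + r) (g' (p r)))))"
        by (simp add: mult.assoc)
    qed
    also have "\<dots> = (-1) ^ j * (Z k (g j) * minor Z {Suc k..<Suc k + n} (?J - {g j}))"
      using Suc.IH[OF mono, of "Suc k"] by (simp add: sum_distrib_left[symmetric] img)
    finally show ?thesis by (simp only: below scale_minus_one_power)
  qed
  have "minor Z {k..<k + Suc n} ?J = row_op Z k (minor Z {Suc k..<Suc k + n}) ?J"
    unfolding rows by (subst minor_insert_min) auto
  also have "\<dots> = (\<Sum>j\<in>{0..<Suc n}. scale ((-1) ^ n_below ?J (g j))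
      (Z k (g j) * minor Z {Suc k..<Suc k + n} (?J - {g j})))"
    unfolding row_op_def by (subst sum.reindex[OF inj]) simp
  finally show ?case
    unfolding sum_permutations_Suc using summand by simp
qed

definition entries :: "nat \<Rightarrow> 'a mat \<Rightarrow> nat \<Rightarrow> nat \<Rightarrow> 'a" where
  "entries N Z r c = (if r < N \<and> c < N then Z $$ (r, c) else 0)"

lemma cluster_var_eq_minor:
  assumes "i + j \<le> N"
  shows "cluster_var Z i (i + j) = minor (entries N Z) {..<i} {j..<j + i}"
proof -
  have "cluster_var Z i (i + j) = (\<Sum>p | p permutes {0..<i}.
      of_int (sign p) * (\<Prod>r\<leftarrow>[0..<i]. entries N Z (0 + r) (j + p r)))"
    unfolding cluster_var_def qdet_def dim_row_mat
  proof (intro sum.cong refl arg_cong2[where f = "(*)"] arg_cong[where f = prod_list] map_cong)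
    fix p r assume "p \<in> {p. p permutes {0..<i}}" "r \<in> set [0..<i]"
    then have "r < i" "p r < i" using permutes_in_image[of p "{0..<i}" r] by auto
    then show "mat i i (\<lambda>(r, c). Z $$ (r, i + j - i + c)) $$ (r, p r) = entries N Z (0 + r) (j + p r)"
      using assms by (simp add: entries_def)
  qed
  also have "\<dots> = minor (entries N Z) {0..<0 + i} ((+) j ` {0..<i})"
    by (rule sum_permutations_minor) (simp add: strict_mono_def)
  also have "(+) j ` {0..<i} = {j..<j + i}"
    by (simp add: add.commute)
  finally show ?thesis by (simp add: atLeast0LessThan)
qed

text \<open>With \<open>N \<ge> 2\<close>, any two entries of a row or a column belong to a \<open>2 \<times> 2\<close> submatrix.\<close>
lemma GLq_mat_iff_qmat:
  assumes "N \<ge> 2"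
  shows "GLq_mat scale q N Z \<longleftrightarrow> Z \<in> carrier_mat N N \<and> qmat (q\<^sup>2) (entries N Z)"
proof
  assume *: "GLq_mat scale q N Z"
  have rel: "Z $$ (i, j) * Z $$ (i, j') = Z $$ (i, j') * Z $$ (i, j) \<and>
      Z $$ (i', j) * Z $$ (i', j') = Z $$ (i', j') * Z $$ (i', j) \<and>
      Z $$ (i, j) * Z $$ (i', j) = scale (q\<^sup>2) (Z $$ (i', j) * Z $$ (i, j)) \<and>
      Z $$ (i, j') * Z $$ (i', j') = scale (q\<^sup>2) (Z $$ (i', j') * Z $$ (i, j')) \<and>
      Z $$ (i, j') * Z $$ (i', j) = scale (q\<^sup>2) (Z $$ (i', j) * Z $$ (i, j')) \<and>
      Z $$ (i, j) * Z $$ (i', j') - Z $$ (i, j') * Z $$ (i', j) =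
        Z $$ (i', j') * Z $$ (i, j) - Z $$ (i', j) * Z $$ (i, j')"
    if "i < i'" "i' < N" "j < j'" "j' < N" for i i' j j'
    using * that unfolding GLq_mat_def Let_def by blast
  have row: "Z $$ (r, a) * Z $$ (r, b) = Z $$ (r, b) * Z $$ (r, a)" if "r < N" "a < b" "b < N" for r a b
  proof (cases "r = 0")
    case True
    then show ?thesis using rel[of 0 1 a b] that assms by simp
  next
    case False
    then show ?thesis using rel[of 0 r a b] that by simp
  qed
  have row': "Z $$ (r, a) * Z $$ (r, b) = Z $$ (r, b) * Z $$ (r, a)" if "r < N" "a < N" "b < N" for r a b
    using row[of r a b] row[of r b a] that by (cases a b rule: linorder_cases) auto
  have col: "Z $$ (r, a) * Z $$ (s, a) = scale (q\<^sup>2) (Z $$ (s, a) * Z $$ (r, a))"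
    if "r < s" "s < N" "a < N" for r s a
  proof (cases "a = 0")
    case True
    then show ?thesis using rel[of r s 0 1] that assms by simp
  next
    case False
    then show ?thesis using rel[of r s 0 a] that by simp
  qed
  have "qmat (q\<^sup>2) (entries N Z)"
    unfolding qmat_def
  proof (intro conjI allI impI)
    fix r a b show "entries N Z r a * entries N Z r b = entries N Z r b * entries N Z r a"
      using row'[of r a b] by (simp add: entries_def)
  next
    fix r s a :: nat assume "r < s"
    then show "entries N Z r a * entries N Z s a = scale (q\<^sup>2) (entries N Z s a * entries N Z r a)"
      using col[of r s a] by (simp add: entries_def)
  next
    fix r s a b :: nat assume l: "r < s" "a < b"
    have "entries N Z r b * entries N Z s a = scale (q\<^sup>2) (entries N Z s a * entries N Z r b) \<and>
      entries N Z r a * entries N Z s b - entries N Z r b * entries N Z s a =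
        entries N Z s b * entries N Z r a - entries N Z s a * entries N Z r b"
    proof (cases "s < N \<and> b < N")
      case True
      then show ?thesis using rel[OF l(1) _ l(2)] l by (simp only: entries_def) auto
    next
      case False
      then show ?thesis by (auto simp: entries_def)
    qed
    then show "entries N Z r b * entries N Z s a = scale (q\<^sup>2) (entries N Z s a * entries N Z r b)"
      "entries N Z r a * entries N Z s b - entries N Z r b * entries N Z s a =
        entries N Z s b * entries N Z r a - entries N Z s a * entries N Z r b"
      by blast+
  qed
  then show "Z \<in> carrier_mat N N \<and> qmat (q\<^sup>2) (entries N Z)"
    using * by (simp add: GLq_mat_def)
next
  assume *: "Z \<in> carrier_mat N N \<and> qmat (q\<^sup>2) (entries N Z)"
  then have q: "qmat (q\<^sup>2) (entries N Z)" ..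
  have e: "Z $$ (r, c) = entries N Z r c" if "r < N" "c < N" for r c
    using that by (simp add: entries_def)
  show "GLq_mat scale q N Z"
    unfolding GLq_mat_def Let_def
  proof (intro conjI allI impI)
    show "Z \<in> carrier_mat N N" using * ..
  next
    fix i i' j j' assume "i < i' \<and> i' < N \<and> j < j' \<and> j' < N"
    then have l: "i < i'" "j < j'" "i < N" "i' < N" "j < N" "j' < N" by auto
    note e' = e[OF l(3) l(5)] e[OF l(3) l(6)] e[OF l(4) l(5)] e[OF l(4) l(6)]
    show "Z $$ (i, j) * Z $$ (i, j') = Z $$ (i, j') * Z $$ (i, j)"
      and "Z $$ (i', j) * Z $$ (i', j') = Z $$ (i', j') * Z $$ (i', j)"
      and "Z $$ (i, j) * Z $$ (i', j) = scale (q\<^sup>2) (Z $$ (i', j) * Z $$ (i, j))"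
      and "Z $$ (i, j') * Z $$ (i', j') = scale (q\<^sup>2) (Z $$ (i', j') * Z $$ (i, j'))"
      and "Z $$ (i, j') * Z $$ (i', j) = scale (q\<^sup>2) (Z $$ (i', j) * Z $$ (i, j'))"
      and "Z $$ (i, j) * Z $$ (i', j') - Z $$ (i, j') * Z $$ (i', j) =
        Z $$ (i', j') * Z $$ (i, j) - Z $$ (i', j) * Z $$ (i, j')"
      unfolding e' using qmat_row[OF q] qmat_col[OF q l(1)] qmat_anti[OF q l(1,2)] qmat_det[OF q l(1,2)]
      by blast+
  qed
qed

text \<open>The variables outside their index range are set to zero, except for the first diagonal entry
  \<open>1\<close> of \<open>T\<^sup>+\<close>, which takes the place of a variable \<open>v\<^sub>0\<close>.\<close>
definition ext_v :: "nat \<Rightarrow> (nat \<Rightarrow> 'a) \<Rightarrow> nat \<Rightarrow> 'a" where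
  "ext_v N v m = (if m = 0 then 1 else if m < N then v m else 0)"

definition ext_a :: "nat \<Rightarrow> (nat \<Rightarrow> nat \<Rightarrow> 'a) \<Rightarrow> nat \<Rightarrow> nat \<Rightarrow> 'a" where
  "ext_a N a m n = (if 1 \<le> n \<and> n \<le> m \<and> m < N then a m n else 0)"

lemma supported_ext: "N \<ge> 1 \<Longrightarrow> supported N (ext_v N v) (ext_a N a)"
  by (simp add: supported_def ext_v_def ext_a_def)

lemma in_vars:
  "V m \<in> vars N \<longleftrightarrow> 1 \<le> m \<and> m < N"
  "A m n \<in> vars N \<longleftrightarrow> 1 \<le> n \<and> n \<le> m \<and> m < N"
  by (auto simp: vars_def)

lemma variables_invertible_ext:
  assumes "\<forall>x\<in>vars N. invertible_elem (var_val v a x)"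
  shows "variables_invertible N (ext_v N v) (ext_a N a)"
proof -
  have "invertible_elem (1 :: 'a)" by (auto simp: invertible_elem_def)
  moreover have "invertible_elem (v m)" if "1 \<le> m" "m < N" for m
    using bspec[OF assms, of "V m"] that by (simp add: in_vars)
  moreover have "invertible_elem (a m n)" if "1 \<le> n" "n \<le> m" "m < N" for m n
    using bspec[OF assms, of "A m n"] that by (simp add: in_vars)
  ultimately show ?thesis by (simp add: variables_invertible_def ext_v_def ext_a_def)
qed

lemma q_relations_imp_torus:
  assumes q: "q \<noteq> 0" and rel: "q_relations scale q N v a"
  shows "torus_relations (q\<^sup>2) (ext_v N v) (ext_a N a)"
proof -
  have R: "q_pair x y \<Longrightarrow> var_val v a x * var_val v a y = scale (q\<^sup>2) (var_val v a y * var_val v a x)"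
    "\<not> q_pair x y \<Longrightarrow> \<not> q_pair y x \<Longrightarrow> var_val v a x * var_val v a y = var_val v a y * var_val v a x"
    if "x \<in> vars N" "y \<in> vars N" for x y
    using rel that unfolding q_relations_def by blast+
  have "ext_v N v m * ext_v N v m' = ext_v N v m' * ext_v N v m" for m m'
    using R(2)[of "V m" "V m'"] by (auto simp: ext_v_def in_vars)
  moreover have "ext_a N a m n * ext_v N v m' = scale (col_weight (q\<^sup>2) m m') (ext_v N v m' * ext_a N a m n)"
    for m n m'
    using R(1)[of "A m n" "V m'"] R(2)[of "A m n" "V m'"]
    by (auto simp: ext_v_def ext_a_def in_vars col_weight_def)
  moreover have "ext_a N a m n * ext_a N a m' n' =
      scale (col_weight (q\<^sup>2) m m' / col_weight (q\<^sup>2) m (m' - 1)) (ext_a N a m' n' * ext_a N a m n)"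
    if later: "n' < n \<or> n' = n \<and> m < m'" for m n m' n'
  proof (cases "A m n \<in> vars N \<and> A m' n' \<in> vars N")
    case False
    then show ?thesis by (auto simp: ext_a_def in_vars)
  next
    case True
    then have vars: "A m n \<in> vars N" "A m' n' \<in> vars N" by simp_all
    have ext: "ext_a N a m n = a m n" "ext_a N a m' n' = a m' n'" and m': "m' \<ge> 1"
      using vars by (auto simp: ext_a_def in_vars)
    consider "m' = m" | "m' = Suc m" | "m' \<noteq> m" "m' \<noteq> Suc m" by blast
    then show ?thesis
    proof cases
      case 1
      then show ?thesis unfolding ext using R(1)[OF vars] later m' by (auto simp: col_weight_def)
    next
      case 2
      have "a m' n' * a m n = scale (q\<^sup>2) (a m n * a m' n')"
        using R(1)[OF vars(2,1)] later 2 by auto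
      then show ?thesis unfolding ext using 2 q by (simp add: col_weight_def)
    next
      case 3
      have "a m n * a m' n' = a m' n' * a m n"
        using R(2)[OF vars] later 3 by auto
      then show ?thesis unfolding ext using 3 m' by (auto simp: col_weight_def)
    qed
  qed
  ultimately show ?thesis unfolding torus_relations_def by blast
qed

lemma torus_imp_q_relations:
  assumes q: "q \<noteq> 0" and rel: "torus_relations (q\<^sup>2) (ext_v N v) (ext_a N a)"
  shows "q_relations scale q N v a"
proof -
  note T = torus_relationsD[OF rel]
  have vv: "v m * v m' = v m' * v m" if "V m \<in> vars N" "V m' \<in> vars N" for m m'
    using T(1)[of m m'] that by (simp add: ext_v_def in_vars)
  have av: "a m n * v m' = scale (col_weight (q\<^sup>2) m m') (v m' * a m n)"
    if "A m n \<in> vars N" "V m' \<in> vars N" for m n m'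
    using T(2)[of m n m'] that by (simp add: ext_v_def ext_a_def in_vars)
  have aa: "a m n * a m' n' = scale (col_weight (q\<^sup>2) m m' / col_weight (q\<^sup>2) m (m' - 1)) (a m' n' * a m n)"
    if "A m n \<in> vars N" "A m' n' \<in> vars N" "n' < n \<or> n' = n \<and> m < m'" for m n m' n'
    using T(3)[of n' n m m'] that by (simp add: ext_a_def in_vars)
  have pair: "var_val v a x * var_val v a y = scale (q\<^sup>2) (var_val v a y * var_val v a x)"
    if xy: "x \<in> vars N" "y \<in> vars N" "q_pair x y" for x y
  proof (cases x)
    case (V m)
    then show ?thesis using xy by simp
  next
    case x: (A m n)
    show ?thesis
    proof (cases y)
      case (V m')
      then show ?thesis using av[of m n m'] xy x by (simp add: col_weight_def)
    next
      case y: (A m' n')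
      have pos: "m' \<ge> 1" using xy(2) y by (simp add: in_vars)
      consider "m' = m" "n' < n" | "m = Suc m'" "n \<le> n'" using xy(3) x y by auto
      then show ?thesis
      proof cases
        case 1
        moreover have "m' - 1 \<noteq> m" using 1 pos by simp
        ultimately show ?thesis using aa[of m n m' n'] xy x y by (simp add: col_weight_def)
      next
        case 2
        then have "n < n' \<or> n = n' \<and> m' < m" by auto
        then have "a m' n' * a m n = scale (1 / q\<^sup>2) (a m n * a m' n')"
          using aa[of m' n' m n] xy x y 2 by (simp add: col_weight_def)
        then show ?thesis using q x y by simp
      qed
    qed
  qed
  have commute_aa: "a m n * a m' n' = a m' n' * a m n"
    if xy: "A m n \<in> vars N" "A m' n' \<in> vars N" and no: "\<not> q_pair (A m n) (A m' n')" "\<not> q_pair (A m' n') (A m n)"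
      and later: "n' < n \<or> n' = n \<and> m < m'" for m n m' n'
  proof -
    have "m' \<noteq> m" "m' - 1 \<noteq> m" using no later xy by (auto simp: in_vars)
    then show ?thesis using aa[OF xy later] by (simp add: col_weight_def)
  qed
  have commute: "var_val v a x * var_val v a y = var_val v a y * var_val v a x"
    if xy: "x \<in> vars N" "y \<in> vars N" and no: "\<not> q_pair x y" "\<not> q_pair y x" for x y
  proof (cases x)
    case x: (V m)
    show ?thesis
    proof (cases y)
      case (V m')
      then show ?thesis using vv xy x by simp
    next
      case (A m' n')
      then show ?thesis using av[of m' n' m] xy no x by (simp add: col_weight_def)
    qed
  next
    case x: (A m n)
    show ?thesis
    proof (cases y)
      case (V m')
      then show ?thesis using av[of m n m'] xy no x by (simp add: col_weight_def)
    next
      case y: (A m' n')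
      consider "n' < n \<or> n' = n \<and> m < m'" | "n < n' \<or> n = n' \<and> m' < m" | "n = n'" "m = m'"
        by linarith
      then show ?thesis
      proof cases
        case 1
        then show ?thesis using commute_aa[of m n m' n'] xy no x y by simp
      next
        case 2
        then show ?thesis using commute_aa[of m' n' m n] xy no x y by simp
      next
        case 3
        then show ?thesis using x y by simp
      qed
    qed
  qed
  show ?thesis unfolding q_relations_def using pair commute by blast
qed

lemma foldr_mat_mult_append:
  assumes "\<And>x. x \<in> set xs \<Longrightarrow> x \<in> carrier_mat N N" "B \<in> carrier_mat N N"
  shows "foldr (*) xs (1\<^sub>m N) \<in> carrier_mat N N \<and> foldr (*) xs B = foldr (*) xs (1\<^sub>m N) * (B :: 'a mat)"
  using assms
proof (induction xs)
  case Nil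
  then show ?case by simp
next
  case (Cons x xs)
  then have "x \<in> carrier_mat N N" "foldr (*) xs (1\<^sub>m N) \<in> carrier_mat N N"
    "foldr (*) xs B = foldr (*) xs (1\<^sub>m N) * B"
    by auto
  then show ?case using Cons.prems(2) by (auto intro: mult_carrier_mat)
qed

lemma A_mat_carrier: "A_mat N a s \<in> carrier_mat N N"
  by (simp add: A_mat_def)

lemma T_plus_carrier: "T_plus N v \<in> carrier_mat N N"
  by (simp add: T_plus_def)

lemma mult_A_mat_entry:
  assumes "M \<in> carrier_mat N N" "r < N" "c < N"
  shows "(M * A_mat N a (Suc s)) $$ (r, c) =
    M $$ (r, c) + (if Suc s \<le> c then M $$ (r, c - 1) * a c (Suc s) else 0)"
proof -
  have "(M * A_mat N a (Suc s)) $$ (r, c) =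
      (\<Sum>k\<in>{0..<N}. M $$ (r, k) * ((if k = c then 1 else 0) + (if c = k + 1 \<and> Suc s \<le> c then a c (Suc s) else 0)))"
    using assms A_mat_carrier[of N a "Suc s"]
    by (auto simp: scalar_prod_def A_mat_def intro!: sum.cong)
  also have "\<dots> = (\<Sum>k\<in>{0..<N}. if k = c then M $$ (r, c) else 0) +
      (\<Sum>k\<in>{0..<N}. if k = c - 1 then (if Suc s \<le> c then M $$ (r, c - 1) * a c (Suc s) else 0) else 0)"
    unfolding sum.distrib[symmetric] by (intro sum.cong refl) (auto simp: distrib_left)
  also have "\<dots> = M $$ (r, c) + (if Suc s \<le> c then M $$ (r, c - 1) * a c (Suc s) else 0)"
    using assms less_imp_diff_less[OF assms(3), of 1] by simp
  finally show ?thesis .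
qed

lemma partial_prod_ext_zero:
  assumes "N \<ge> 1" "N \<le> r \<or> N \<le> c"
  shows "partial_prod (ext_v N v) (ext_a N a) s r c = 0"
proof (cases "c < r")
  case True
  then show ?thesis by (simp add: partial_prod_zero)
next
  case False
  then have "N \<le> c" using assms(2) by auto
  then show ?thesis
    by (induction s) (use assms(1) in \<open>auto simp: ext_v_def ext_a_def\<close>)
qed

lemma entries_partial_product:
  fixes v :: "nat \<Rightarrow> 'a" and a :: "nat \<Rightarrow> nat \<Rightarrow> 'a"
  assumes "N \<ge> 1" "s < N"
  defines "M \<equiv> T_plus N v * foldr (*) (map (A_mat N a) [1..<Suc s]) (1\<^sub>m N)"
  shows "M \<in> carrier_mat N N \<and> entries N M = partial_prod (ext_v N v) (ext_a N a) s"
  unfolding M_def using assms(2)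
proof (induction s)
  case 0
  have "entries N (T_plus N v) = partial_prod (ext_v N v) (ext_a N a) 0"
    using assms(1) by (intro ext) (auto simp: entries_def T_plus_def mat_diag_def ext_v_def)
  then show ?case using T_plus_carrier[of N v] by simp
next
  case (Suc s)
  let ?F = "\<lambda>s. foldr (*) (map (A_mat N a) [1..<Suc s]) (1\<^sub>m N)"
  let ?M = "T_plus N v * ?F s"
  have M: "?M \<in> carrier_mat N N" "entries N ?M = partial_prod (ext_v N v) (ext_a N a) s"
    using Suc by auto
  have app: "?F s \<in> carrier_mat N N \<and>
      foldr (*) (map (A_mat N a) [1..<Suc s]) (A_mat N a (Suc s)) = ?F s * A_mat N a (Suc s)"
    by (rule foldr_mat_mult_append) (auto simp: A_mat_carrier)
  have "[1..<Suc (Suc s)] = [1..<Suc s] @ [Suc s]" by simp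
  then have F: "?F s \<in> carrier_mat N N" "?F (Suc s) = ?F s * A_mat N a (Suc s)"
    using app right_mult_one_mat[OF A_mat_carrier[of N a "Suc s"]] by (simp_all del: upt_Suc)
  have eq: "T_plus N v * ?F (Suc s) = ?M * A_mat N a (Suc s)"
    unfolding F(2) using F(1) T_plus_carrier[of N v] A_mat_carrier[of N a "Suc s"]
    by (simp only: assoc_mult_mat)
  have "entries N (?M * A_mat N a (Suc s)) r c = partial_prod (ext_v N v) (ext_a N a) (Suc s) r c" for r c
  proof (cases "r < N \<and> c < N")
    case False
    then show ?thesis using partial_prod_ext_zero[OF assms(1), of r c v a "Suc s"]
      by (auto simp: entries_def not_less simp del: partial_prod.simps)
  next
    case True
    have "?M $$ (r, c') = partial_prod (ext_v N v) (ext_a N a) s r c'" if "c' < N" for c'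
      using fun_cong[OF fun_cong[OF M(2)], of r c'] True that by (simp add: entries_def)
    from this[of c] this[of "c - 1"] show ?thesis
      using mult_A_mat_entry[OF M(1), of r c a s] True
      by (auto simp: entries_def ext_a_def)
  qed
  then show ?case unfolding eq using M(1) A_mat_carrier[of N a "Suc s"]
    by (auto simp del: partial_prod.simps)
qed

lemma entries_product:
  assumes "N \<ge> 2"
  shows "T_plus N v * U_plus N a \<in> carrier_mat N N"
    and "entries N (T_plus N v * U_plus N a) = partial_prod (ext_v N v) (ext_a N a) (N - 1)"
  using entries_partial_product[of N "N - 1" v a] assms by (simp_all add: U_plus_def)

lemma GLq_product_iff_q_relations:
  assumes N: "N \<ge> 2" and q: "q \<noteq> 0" and inv: "\<forall>x\<in>vars N. invertible_elem (var_val v a x)"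
  shows "GLq_mat scale q N (T_plus N v * U_plus N a) \<longleftrightarrow> q_relations scale q N v a"
proof -
  have "GLq_mat scale q N (T_plus N v * U_plus N a) \<longleftrightarrow>
      qmat (q\<^sup>2) (partial_prod (ext_v N v) (ext_a N a) (N - 1))"
    using entries_product[OF N] by (simp add: GLq_mat_iff_qmat[OF N])
  also have "\<dots> \<longleftrightarrow> torus_relations (q\<^sup>2) (ext_v N v) (ext_a N a)"
    using qmat_imp_torus_relations[OF _ supported_ext variables_invertible_ext[OF inv]]
      torus_relations_imp_qmat[OF _ _ supported_ext] N q by auto
  also have "\<dots> \<longleftrightarrow> q_relations scale q N v a"
    using q_relations_imp_torus[OF q] torus_imp_q_relations[OF q] by blast
  finally show ?thesis .
qed

lemma cluster_var_monomial:
  assumes N: "N \<ge> 2" and q: "q \<noteq> 0" and rel: "q_relations scale q N v a" and ij: "i \<ge> 1" "i + j \<le> N"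
  shows "cluster_var (T_plus N v * U_plus N a) i (i + j) =
    (\<Prod>m\<leftarrow>[1..<i + 1]. \<Prod>n\<leftarrow>[1..<j + 1]. a (m + n - 1) n) * (\<Prod>k\<leftarrow>[1..<i]. v k)"
proof -
  have "cluster_var (T_plus N v * U_plus N a) i (i + j) =
      minor (partial_prod (ext_v N v) (ext_a N a) (N - 1)) {..<i} {j..<j + i}"
    using ij(2) by (simp add: cluster_var_eq_minor entries_product[OF N])
  also have "\<dots> = (\<Prod>m\<leftarrow>[1..<i + 1]. \<Prod>n\<leftarrow>[1..<j + 1]. ext_a N a (m + n - 1) n) *
      (\<Prod>k\<leftarrow>[1..<i]. ext_v N v k)"
    using N q ij by (intro minor_monomial[OF _ q_relations_imp_torus[OF q rel] supported_ext])
      (auto simp: ext_v_def)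
  also have "(\<Prod>k\<leftarrow>[1..<i]. ext_v N v k) = (\<Prod>k\<leftarrow>[1..<i]. v k)"
    using ij by (intro arg_cong[where f = prod_list] map_cong refl) (auto simp: ext_v_def)
  also have "(\<Prod>m\<leftarrow>[1..<i + 1]. \<Prod>n\<leftarrow>[1..<j + 1]. ext_a N a (m + n - 1) n) =
      (\<Prod>m\<leftarrow>[1..<i + 1]. \<Prod>n\<leftarrow>[1..<j + 1]. a (m + n - 1) n)"
    using ij by (intro arg_cong[where f = prod_list] map_cong refl) (auto simp: ext_a_def)
  finally show ?thesis .
qed

lemma cluster_var_commute:
  assumes N: "N \<ge> 2" and q: "q \<noteq> 0" and Z: "GLq_mat scale q N Z"
    and ij: "i + j \<le> N" and kl: "k + l \<le> N"
  shows "cluster_var Z i (i + j) * cluster_var Z k (k + l) =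
    scale (q powi (2 * P_exp i j k l)) (cluster_var Z k (k + l) * cluster_var Z i (i + j))"
proof -
  have qm: "qmat (q\<^sup>2) (entries N Z)" using Z GLq_mat_iff_qmat[OF N] by simp
  have pow: "(q\<^sup>2) powi e = q powi (2 * e)" for e
    by (simp add: power_int_mult)
  have le: "cluster_var Z i (i + j) * cluster_var Z k (k + l) =
    scale (q powi (2 * P_exp i j k l)) (cluster_var Z k (k + l) * cluster_var Z i (i + j))"
    if "k \<le> i" "i + j \<le> N" "k + l \<le> N" for i j k l
    using minor_commute_minor[OF qm _ that(1), of j l] q that(2,3)
    by (simp add: cluster_var_eq_minor P_exp_eq_sum[OF that(1)] pow)
  show ?thesis
  proof (cases "k \<le> i")
    case True
    then show ?thesis using le ij kl by blast
  next
    case False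
    then have "cluster_var Z k (k + l) * cluster_var Z i (i + j) =
      scale (q powi (2 * P_exp k l i j)) (cluster_var Z i (i + j) * cluster_var Z k (k + l))"
      using le ij kl by simp
    then have "scale (q powi (2 * P_exp i j k l)) (cluster_var Z k (k + l) * cluster_var Z i (i + j)) =
      scale (q powi (2 * P_exp i j k l) * q powi (- (2 * P_exp i j k l)))
        (cluster_var Z i (i + j) * cluster_var Z k (k + l))"
      by (simp add: P_exp_antisym[of k l i j])
    also have "q powi (2 * P_exp i j k l) * q powi (- (2 * P_exp i j k l)) = 1"
      using q by (simp add: power_int_add[symmetric])
    finally show ?thesis by simp
  qed
qed

end

theorem theorem5p1:
  fixes scale :: "complex \<Rightarrow> 'a::ring_1 \<Rightarrow> 'a" and q :: complex and N :: nat
  assumes "complex_algebra scale"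
    and "N \<ge> 2"
    and "q \<noteq> 0"
    and "\<forall>n::nat. n \<ge> 1 \<longrightarrow> q ^ n \<noteq> 1"
  shows "(\<forall>(v :: nat \<Rightarrow> 'a) (a :: nat \<Rightarrow> nat \<Rightarrow> 'a).
            (\<forall>x\<in>vars N. invertible_elem (var_val v a x)) \<longrightarrow>
            (GLq_mat scale q N (T_plus N v * U_plus N a) \<longleftrightarrow> q_relations scale q N v a) \<and>
            (GLq_mat scale q N (T_plus N v * U_plus N a) \<longrightarrow>
              (\<forall>i j. i \<ge> 1 \<and> j \<ge> 1 \<and> i + j \<le> N \<longrightarrow>
                cluster_var (T_plus N v * U_plus N a) i (i + j) =
                  (\<Prod>m\<leftarrow>[1..<i + 1]. \<Prod>n\<leftarrow>[1..<j + 1]. a (m + n - 1) n) * (\<Prod>k\<leftarrow>[1..<i]. v k))))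
       \<and> (\<forall>Z :: 'a mat. GLq_mat scale q N Z \<longrightarrow>
            (\<forall>i j k l. i \<ge> 1 \<and> j \<ge> 1 \<and> k \<ge> 1 \<and> l \<ge> 1 \<and> i + j \<le> N \<and> k + l \<le> N \<longrightarrow>
              cluster_var Z i (i + j) * cluster_var Z k (k + l) =
                scale (q powi (2 * P_exp i j k l))
                  (cluster_var Z k (k + l) * cluster_var Z i (i + j)) \<and>
              P_exp k l i j = - P_exp i j k l))"
proof -
  interpret complex_algebra scale by fact
  show ?thesis
  proof (intro conjI allI impI)
    fix v :: "nat \<Rightarrow> 'a" and a :: "nat \<Rightarrow> nat \<Rightarrow> 'a"
    assume inv: "\<forall>x\<in>vars N. invertible_elem (var_val v a x)"
    show iff: "GLq_mat scale q N (T_plus N v * U_plus N a) \<longleftrightarrow> q_relations scale q N v a"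
      by (rule GLq_product_iff_q_relations[OF assms(2,3) inv])
    fix i j assume "GLq_mat scale q N (T_plus N v * U_plus N a)"
      and ij: "i \<ge> 1 \<and> j \<ge> 1 \<and> i + j \<le> N"
    then show "cluster_var (T_plus N v * U_plus N a) i (i + j) =
        (\<Prod>m\<leftarrow>[1..<i + 1]. \<Prod>n\<leftarrow>[1..<j + 1]. a (m + n - 1) n) * (\<Prod>k\<leftarrow>[1..<i]. v k)"
      by (intro cluster_var_monomial[OF assms(2,3)]) (auto simp only: iff)
  next
    fix Z :: "'a mat" and i j k l
    assume "GLq_mat scale q N Z"
      and "i \<ge> 1 \<and> j \<ge> 1 \<and> k \<ge> 1 \<and> l \<ge> 1 \<and> i + j \<le> N \<and> k + l \<le> N"
    then show "cluster_var Z i (i + j) * cluster_var Z k (k + l) =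
        scale (q powi (2 * P_exp i j k l)) (cluster_var Z k (k + l) * cluster_var Z i (i + j))"
      by (intro cluster_var_commute[OF assms(2,3)]) simp_all
  qed (rule P_exp_antisym)
qed

end
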